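(* Let $F$ be a field of characteristic $0$, let $\gamma\in F$, $\gamma\neq 0$, and let $\mathbb{M}=\mathbb{M}_\gamma$ be the 5-dimensional solvable Malcev algebra over $F$ with basis $a,b,c,d,e$ and nonzero brackets (up to anticommutativity) $[b,c]=2d$, $[a,b]=-b$, $[a,c]=-c$, $[a,d]=d$, $[a,e]=\gamma e$. The universal alternative enveloping algebra $A(\mathbb{M})$ has as $F$-basis the (cosets of the) monomials $a^id$ and $a^ib^jc^ke^m$ with $i,j,k,m\ge 0$, and its structure constants are, for all nonnegative integer exponents, $$a^id\cdot a^rd=0,$$ $$a^id\cdot a^rb^nc^pe^s=\delta_{0n}\delta_{0p}\delta_{0s}\,a^i(a-1)^rd,$$ $$a^ib^jc^ke^m\cdot a^rd=\delta_{j0}\delta_{k0}\delta_{m0}\,a^{i+r}d,$$ $$a^ib^jc^ke^m\cdot a^rb^nc^pe^s=a^i(a+j+k-\gamma m)^rb^{j+n}c^{k+p}e^{m+s}+\delta_{m,0}\delta_{s,0}\delta_{j+n,1}\delta_{k+p,1}T^{ir}_{jk},$$ where $$T^{ir}_{jk}=\begin{cases}0&\text{if }(j,k)=(0,0),\\ (a-1)^{i+r}d-a^i(a+1)^rd&\text{if }(j,k)=(1,0),\\ -(a-1)^{i+r}d-a^i(a+1)^rd&\text{if }(j,k)=(0,1),\\ a^i(a-1)^rd-a^i(a+2)^rd&\text{if }(j,k)=(1,1).\end{cases}$$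
   Context: A Malcev algebra is an anticommutative algebra $(M,[\cdot,\cdot])$ with $J(x,y,[x,z])=[J(x,y,z),x]$, where $J(x,y,z)=[[x,y],z]+[[y,z],x]+[[z,x],y]$. In a nonassociative algebra, $(x,y,z)=(xy)z-x(yz)$. The universal nonassociative enveloping algebra of a Malcev algebra $M$ is $U(M)=F(M)/R(M)$, where $F(M)$ is the unital free nonassociative algebra on a basis of $M$ and $R(M)$ is the ideal generated by $st-ts-[s,t]$, $(s,x,y)+(x,s,y)$, $(x,s,y)+(x,y,s)$ for all $s,t\in M$, $x,y\in F(M)$; $M$ embeds in $U(M)$ and is identified with its image. For the ordered basis $a<b<c<d<e$, $a^ib^jc^kd^le^m$ denotes the left-tapped monomial $a(a(\cdots(b(\cdots(c(\cdots(d(\cdots(e\,e)\cdots)$ with $i$ factors $a$, then $j$ factors $b$, and so on, bracketed from the right; these monomials form an $F$-basis of $U(\mathbb{M})$. The alternator ideal $I(M)$ is the ideal of $U(M)$ generated by all $(x,x,y)$ and $(y,x,x)$, $x,y\in U(M)$; the universal alternative enveloping algebra of $M$ is $A(M)=U(M)/I(M)$, the maximal alternative quotient of $U(M)$. Expressions such as $a^i(a+t)^rb^jc^ke^m$ or $(a-1)^rd$ are expanded in powers of $a$ to give linear combinations of the corresponding monomials. $\delta$ is the Kronecker delta. *)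

theory Defs
  imports
    "HOL-Library.Poly_Mapping"
    "HOL-Computational_Algebra.Polynomial"
    "HOL-Algebra.QuotRing"
    "HOL-Algebra.Module"
begin

section \<open>Nonassociative algebras\<close>

text \<open>
  A unital nonassociative algebra over a field \<open>'k\<close> is represented by a record of type
  \<open>('k, 'v) module\<close>, whose fields are the carrier, the two ring operations with their units, and
  the scalar multiplication.  The locales of HOL-Algebra for rings are not used, since they
  assume associativity.
\<close>

definition associator :: "('k, 'v) module \<Rightarrow> 'v \<Rightarrow> 'v \<Rightarrow> 'v \<Rightarrow> 'v" where
  "associator A x y z = (x \<otimes>\<^bsub>A\<^esub> y) \<otimes>\<^bsub>A\<^esub> z \<ominus>\<^bsub>A\<^esub> x \<otimes>\<^bsub>A\<^esub> (y \<otimes>\<^bsub>A\<^esub> z)"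

definition alg_ideal :: "('k, 'v) module \<Rightarrow> 'v set \<Rightarrow> bool" where
  "alg_ideal A I \<longleftrightarrow> additive_subgroup I A \<and>
     (\<forall>r. \<forall>x\<in>I. r \<odot>\<^bsub>A\<^esub> x \<in> I) \<and>
     (\<forall>x\<in>I. \<forall>y\<in>carrier A. x \<otimes>\<^bsub>A\<^esub> y \<in> I \<and> y \<otimes>\<^bsub>A\<^esub> x \<in> I)"

definition generated_ideal :: "('k, 'v) module \<Rightarrow> 'v set \<Rightarrow> 'v set" where
  "generated_ideal A S = \<Inter>{I. alg_ideal A I \<and> S \<subseteq> I}"

definition quotient_algebra :: "('k, 'v) module \<Rightarrow> 'v set \<Rightarrow> ('k, 'v set) module" where
  "quotient_algebra A I =
     ring.extend (A Quot I) (module.fields (\<lambda>r X. \<Union>x\<in>X. I +>\<^bsub>A\<^esub> (r \<odot>\<^bsub>A\<^esub> x)))"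

definition lincomb :: "('k::zero, 'v) module \<Rightarrow> ('i \<Rightarrow> 'v) \<Rightarrow> ('i \<Rightarrow>\<^sub>0 'k) \<Rightarrow> 'v" where
  "lincomb A v c = (\<Oplus>\<^bsub>A\<^esub>i\<in>Poly_Mapping.keys c. Poly_Mapping.lookup c i \<odot>\<^bsub>A\<^esub> v i)"

definition is_basis :: "('k::zero, 'v) module \<Rightarrow> ('i \<Rightarrow> 'v) \<Rightarrow> bool" where
  "is_basis A v \<longleftrightarrow> range v \<subseteq> carrier A \<and>
     (\<forall>c. lincomb A v c = \<zero>\<^bsub>A\<^esub> \<longrightarrow> c = 0) \<and>
     (\<forall>x\<in>carrier A. \<exists>c. x = lincomb A v c)"

text \<open>
  For a family \<open>v 0, v 1, v 2, \<dots>\<close>, where \<open>v q\<close> stands for an expression of the form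
  \<open>a\<^sup>q w\<close>, and a polynomial \<open>p\<close>, the element \<open>expand A v p\<close> is \<open>p(a) w\<close> expanded in powers of \<open>a\<close>.
\<close>

definition expand :: "('k::zero, 'v) module \<Rightarrow> (nat \<Rightarrow> 'v) \<Rightarrow> 'k poly \<Rightarrow> 'v" where
  "expand A v p = (\<Oplus>\<^bsub>A\<^esub>q\<in>{..degree p}. coeff p q \<odot>\<^bsub>A\<^esub> v q)"

text \<open>
  The left-tapped monomial \<open>x\<^sub>1 (x\<^sub>2 (\<dots> (x\<^sub>n\<^sub>-\<^sub>1 x\<^sub>n) \<dots>))\<close>; the innermost product with the unit
  only serves to cover the empty monomial.
\<close>

definition left_tapped :: "('k, 'v) module \<Rightarrow> 'v list \<Rightarrow> 'v" where
  "left_tapped A xs = foldr (\<lambda>x y. x \<otimes>\<^bsub>A\<^esub> y) xs \<one>\<^bsub>A\<^esub>"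


section \<open>Free vector spaces and Malcev algebras\<close>

text \<open>
  The vector space with basis \<open>'g\<close> is \<open>'g \<Rightarrow>\<^sub>0 'k\<close>; the basis vector belonging to \<open>g\<close> is
  \<open>Poly_Mapping.single g 1\<close>.
\<close>

definition pm_scale :: "'k::field \<Rightarrow> ('g \<Rightarrow>\<^sub>0 'k) \<Rightarrow> ('g \<Rightarrow>\<^sub>0 'k)" where
  "pm_scale r x = Poly_Mapping.map (\<lambda>s. r * s) x"

definition bilinear_extension ::
    "('g \<Rightarrow> 'g \<Rightarrow> ('h \<Rightarrow>\<^sub>0 'k::field)) \<Rightarrow> ('g \<Rightarrow>\<^sub>0 'k) \<Rightarrow> ('g \<Rightarrow>\<^sub>0 'k) \<Rightarrow> ('h \<Rightarrow>\<^sub>0 'k)" where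
  "bilinear_extension B x y =
     (\<Sum>g\<in>Poly_Mapping.keys x. \<Sum>h\<in>Poly_Mapping.keys y.
        pm_scale (Poly_Mapping.lookup x g * Poly_Mapping.lookup y h) (B g h))"

type_synonym ('g, 'k) bracket = "('g \<Rightarrow>\<^sub>0 'k) \<Rightarrow> ('g \<Rightarrow>\<^sub>0 'k) \<Rightarrow> ('g \<Rightarrow>\<^sub>0 'k)"

definition jacobian ::
    "('g, 'k::field) bracket \<Rightarrow> ('g \<Rightarrow>\<^sub>0 'k) \<Rightarrow> ('g \<Rightarrow>\<^sub>0 'k) \<Rightarrow> ('g \<Rightarrow>\<^sub>0 'k) \<Rightarrow> ('g \<Rightarrow>\<^sub>0 'k)" where
  "jacobian br x y z = br (br x y) z + br (br y z) x + br (br z x) y"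

definition malcev_bracket :: "('g, 'k::field) bracket \<Rightarrow> bool" where
  "malcev_bracket br \<longleftrightarrow>
     (\<forall>x y z. br (x + y) z = br x z + br y z \<and> br x (y + z) = br x y + br x z) \<and>
     (\<forall>r x y. br (pm_scale r x) y = pm_scale r (br x y) \<and>
              br x (pm_scale r y) = pm_scale r (br x y)) \<and>
     (\<forall>x. br x x = 0) \<and>
     (\<forall>x y z. jacobian br x y (br x z) = br (jacobian br x y z) x)"


section \<open>The free nonassociative algebra and the enveloping algebras\<close>

text \<open>
  Nonempty nonassociative words are binary trees; \<open>None\<close> is the empty word, i.e. the unit.
\<close>

datatype 'g nword = Letter 'g | Times "'g nword" "'g nword"

fun word_mult :: "'g nword option \<Rightarrow> 'g nword option \<Rightarrow> 'g nword option" where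
  "word_mult None v = v"
| "word_mult u None = u"
| "word_mult (Some u) (Some v) = Some (Times u v)"

type_synonym ('g, 'k) free = "'g nword option \<Rightarrow>\<^sub>0 'k"

definition free_algebra :: "('k::field, ('g, 'k) free) module" where
  "free_algebra =
     \<lparr>carrier = UNIV,
      mult = bilinear_extension (\<lambda>u v. Poly_Mapping.single (word_mult u v) 1),
      one = Poly_Mapping.single None 1,
      zero = 0,
      add = (+),
      smult = pm_scale\<rparr>"

definition embed :: "('g \<Rightarrow>\<^sub>0 'k::field) \<Rightarrow> ('g, 'k) free" where
  "embed x = (\<Sum>g\<in>Poly_Mapping.keys x.
     Poly_Mapping.single (Some (Letter g)) (Poly_Mapping.lookup x g))"

definition envelope_relations :: "('g, 'k::field) bracket \<Rightarrow> ('g, 'k) free set" where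
  "envelope_relations br =
     {embed s \<otimes>\<^bsub>free_algebra\<^esub> embed t \<ominus>\<^bsub>free_algebra\<^esub> embed t \<otimes>\<^bsub>free_algebra\<^esub> embed s
        \<ominus>\<^bsub>free_algebra\<^esub> embed (br s t) | s t. True} \<union>
     {associator free_algebra (embed s) x y \<oplus>\<^bsub>free_algebra\<^esub>
        associator free_algebra x (embed s) y | s x y. True} \<union>
     {associator free_algebra x (embed s) y \<oplus>\<^bsub>free_algebra\<^esub>
        associator free_algebra x y (embed s) | s x y. True}"

definition envelope_ideal :: "('g, 'k::field) bracket \<Rightarrow> ('g, 'k) free set" where
  "envelope_ideal br = generated_ideal free_algebra (envelope_relations br)"

definition envelope :: "('g, 'k::field) bracket \<Rightarrow> ('k, ('g, 'k) free set) module" where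
  "envelope br = quotient_algebra free_algebra (envelope_ideal br)"

definition envelope_embed ::
    "('g, 'k::field) bracket \<Rightarrow> ('g \<Rightarrow>\<^sub>0 'k) \<Rightarrow> ('g, 'k) free set" where
  "envelope_embed br x = envelope_ideal br +>\<^bsub>free_algebra\<^esub> embed x"

definition alternator_ideal :: "('g, 'k::field) bracket \<Rightarrow> ('g, 'k) free set set" where
  "alternator_ideal br = generated_ideal (envelope br)
     ({associator (envelope br) x x y | x y.
         x \<in> carrier (envelope br) \<and> y \<in> carrier (envelope br)} \<union>
      {associator (envelope br) y x x | x y.
         x \<in> carrier (envelope br) \<and> y \<in> carrier (envelope br)})"

definition alt_envelope :: "('g, 'k::field) bracket \<Rightarrow> ('k, ('g, 'k) free set set) module" where
  "alt_envelope br = quotient_algebra (envelope br) (alternator_ideal br)"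


section \<open>The five-dimensional algebra\<close>

datatype gen = Ga | Gb | Gc | Gd | Ge

fun gen_bracket :: "'k::field \<Rightarrow> gen \<Rightarrow> gen \<Rightarrow> (gen \<Rightarrow>\<^sub>0 'k)" where
  "gen_bracket \<gamma> Gb Gc = Poly_Mapping.single Gd 2"
| "gen_bracket \<gamma> Gc Gb = Poly_Mapping.single Gd (- 2)"
| "gen_bracket \<gamma> Ga Gb = Poly_Mapping.single Gb (- 1)"
| "gen_bracket \<gamma> Gb Ga = Poly_Mapping.single Gb 1"
| "gen_bracket \<gamma> Ga Gc = Poly_Mapping.single Gc (- 1)"
| "gen_bracket \<gamma> Gc Ga = Poly_Mapping.single Gc 1"
| "gen_bracket \<gamma> Ga Gd = Poly_Mapping.single Gd 1"
| "gen_bracket \<gamma> Gd Ga = Poly_Mapping.single Gd (- 1)"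
| "gen_bracket \<gamma> Ga Ge = Poly_Mapping.single Ge \<gamma>"
| "gen_bracket \<gamma> Ge Ga = Poly_Mapping.single Ge (- \<gamma>)"
| "gen_bracket \<gamma> _ _ = 0"

definition M_bracket :: "'k::field \<Rightarrow> (gen, 'k) bracket" where
  "M_bracket \<gamma> = bilinear_extension (gen_bracket \<gamma>)"

lemma UNIV_gen: "(UNIV :: gen set) = {Ga, Gb, Gc, Gd, Ge}"
  using gen.exhaust by auto

instance gen :: finite
  by standard (simp add: UNIV_gen)

lemma lookup_pm_scale: "Poly_Mapping.lookup (pm_scale r x) g = r * Poly_Mapping.lookup x g"
  unfolding pm_scale_def by (simp add: map.rep_eq when_def)

lemma bilinear_extension_UNIV:
  fixes x y :: "'g::finite \<Rightarrow>\<^sub>0 'k::field"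
  shows "bilinear_extension B x y =
    (\<Sum>g\<in>UNIV. \<Sum>h\<in>UNIV. pm_scale (Poly_Mapping.lookup x g * Poly_Mapping.lookup y h) (B g h))"
proof -
  have z: "pm_scale 0 v = 0" for v :: "'h \<Rightarrow>\<^sub>0 'k"
    by (rule poly_mapping_eqI) (simp add: lookup_pm_scale)
  have "(\<Sum>h\<in>Poly_Mapping.keys y. pm_scale (Poly_Mapping.lookup x g * Poly_Mapping.lookup y h) (B g h))
      = (\<Sum>h\<in>UNIV. pm_scale (Poly_Mapping.lookup x g * Poly_Mapping.lookup y h) (B g h))" for g
    by (rule sum.mono_neutral_left) (auto simp: z in_keys_iff)
  then have "bilinear_extension B x y = (\<Sum>g\<in>Poly_Mapping.keys x. \<Sum>h\<in>UNIV.
      pm_scale (Poly_Mapping.lookup x g * Poly_Mapping.lookup y h) (B g h))"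
    by (simp add: bilinear_extension_def)
  also have "\<dots> = (\<Sum>g\<in>UNIV. \<Sum>h\<in>UNIV.
      pm_scale (Poly_Mapping.lookup x g * Poly_Mapping.lookup y h) (B g h))"
    by (rule sum.mono_neutral_left) (auto simp: z in_keys_iff)
  finally show ?thesis .
qed

lemma lookup_M_bracket:
  fixes \<gamma> :: "'k::field" and x y :: "gen \<Rightarrow>\<^sub>0 'k"
  defines "p \<equiv> Poly_Mapping.lookup x" and "q \<equiv> Poly_Mapping.lookup y"
  shows "Poly_Mapping.lookup (M_bracket \<gamma> x y) Ga = 0"
    "Poly_Mapping.lookup (M_bracket \<gamma> x y) Gb = p Gb * q Ga - p Ga * q Gb"
    "Poly_Mapping.lookup (M_bracket \<gamma> x y) Gc = p Gc * q Ga - p Ga * q Gc"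
    "Poly_Mapping.lookup (M_bracket \<gamma> x y) Gd =
       p Ga * q Gd - p Gd * q Ga + 2 * (p Gb * q Gc - p Gc * q Gb)"
    "Poly_Mapping.lookup (M_bracket \<gamma> x y) Ge = \<gamma> * (p Ga * q Ge - p Ge * q Ga)"
  unfolding M_bracket_def bilinear_extension_UNIV p_def q_def
  by (simp_all add: UNIV_gen lookup_add lookup_pm_scale lookup_single algebra_simps)

lemma gen_pm_eqI:
  assumes "Poly_Mapping.lookup x Ga = Poly_Mapping.lookup y Ga"
    "Poly_Mapping.lookup x Gb = Poly_Mapping.lookup y Gb"
    "Poly_Mapping.lookup x Gc = Poly_Mapping.lookup y Gc"
    "Poly_Mapping.lookup x Gd = Poly_Mapping.lookup y Gd"
    "Poly_Mapping.lookup x Ge = Poly_Mapping.lookup y Ge"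
  shows "x = y"
proof (rule poly_mapping_eqI)
  fix g show "Poly_Mapping.lookup x g = Poly_Mapping.lookup y g"
    using assms by (cases g) simp_all
qed

lemma malcev_M_bracket: "malcev_bracket (M_bracket \<gamma>)"
  unfolding malcev_bracket_def
  by (intro conjI allI; rule gen_pm_eqI;
      simp add: jacobian_def lookup_add lookup_pm_scale lookup_M_bracket;
      simp add: algebra_simps)

definition delta :: "nat \<Rightarrow> nat \<Rightarrow> 'k::field" where
  "delta i j = (if i = j then 1 else 0)"

abbreviation AM :: "'k::field \<Rightarrow> ('k, (gen, 'k) free set set) module" where
  "AM \<gamma> \<equiv> alt_envelope (M_bracket \<gamma>)"

definition monomial_U :: "'k::field \<Rightarrow> nat \<Rightarrow> nat \<Rightarrow> nat \<Rightarrow> nat \<Rightarrow> nat \<Rightarrow> (gen, 'k) free set" where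
  "monomial_U \<gamma> i j k l m = left_tapped (envelope (M_bracket \<gamma>))
     (map (\<lambda>g. envelope_embed (M_bracket \<gamma>) (Poly_Mapping.single g 1))
        (replicate i Ga @ replicate j Gb @ replicate k Gc @ replicate l Gd @ replicate m Ge))"

definition monomial_A :: "'k::field \<Rightarrow> nat \<Rightarrow> nat \<Rightarrow> nat \<Rightarrow> nat \<Rightarrow> nat \<Rightarrow> (gen, 'k) free set set" where
  "monomial_A \<gamma> i j k l m =
     alternator_ideal (M_bracket \<gamma>) +>\<^bsub>envelope (M_bracket \<gamma>)\<^esub> monomial_U \<gamma> i j k l m"

definition mon_d :: "'k::field \<Rightarrow> nat \<Rightarrow> (gen, 'k) free set set" where
  "mon_d \<gamma> i = monomial_A \<gamma> i 0 0 1 0"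

definition mon_abce :: "'k::field \<Rightarrow> nat \<Rightarrow> nat \<Rightarrow> nat \<Rightarrow> nat \<Rightarrow> (gen, 'k) free set set" where
  "mon_abce \<gamma> i j k m = monomial_A \<gamma> i j k 0 m"

fun basis_family :: "'k::field \<Rightarrow> nat + nat \<times> nat \<times> nat \<times> nat \<Rightarrow> (gen, 'k) free set set" where
  "basis_family \<gamma> (Inl i) = mon_d \<gamma> i"
| "basis_family \<gamma> (Inr (i, j, k, m)) = mon_abce \<gamma> i j k m"

text \<open>\<open>pol_d \<gamma> p\<close> is \<open>p(a) d\<close>, and \<open>pol_abce \<gamma> p j k m\<close> is \<open>p(a) b\<^sup>j c\<^sup>k e\<^sup>m\<close>.\<close>

definition pol_d :: "'k::field \<Rightarrow> 'k poly \<Rightarrow> (gen, 'k) free set set" where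
  "pol_d \<gamma> p = expand (AM \<gamma>) (\<lambda>q. mon_d \<gamma> q) p"

definition pol_abce :: "'k::field \<Rightarrow> 'k poly \<Rightarrow> nat \<Rightarrow> nat \<Rightarrow> nat \<Rightarrow> (gen, 'k) free set set" where
  "pol_abce \<gamma> p j k m = expand (AM \<gamma>) (\<lambda>q. mon_abce \<gamma> q j k m) p"

text \<open>
  \<open>ashift t\<close> is the polynomial \<open>a + t\<close> in the indeterminate \<open>a\<close>; in particular \<open>ashift 0\<close>
  is \<open>a\<close>.
\<close>

definition ashift :: "'k::field \<Rightarrow> 'k poly" where
  "ashift t = [:t, 1:]"

text \<open>
  Only \<open>j, k \<le> 1\<close> is meaningful here: for other values the correction term below has
  coefficient \<open>0\<close>.
\<close>

definition T :: "'k::field \<Rightarrow> nat \<Rightarrow> nat \<Rightarrow> nat \<Rightarrow> nat \<Rightarrow> (gen, 'k) free set set" where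
  "T \<gamma> i r j k =
     (if (j, k) = (1, 0) then pol_d \<gamma> (ashift (- 1) ^ (i + r) - ashift 0 ^ i * ashift 1 ^ r)
      else if (j, k) = (0, 1) then pol_d \<gamma> (- (ashift (- 1) ^ (i + r)) - ashift 0 ^ i * ashift 1 ^ r)
      else if (j, k) = (1, 1) then pol_d \<gamma> (ashift 0 ^ i * ashift (- 1) ^ r - ashift 0 ^ i * ashift 2 ^ r)
      else \<zero>\<^bsub>AM \<gamma>\<^esub>)"

end

theory Submission
  imports Defs "HOL-Library.Function_Algebras"
begin

text \<open>
Write \<open>A\<close> for the universal alternative enveloping algebra. It is the quotient of the free nonassociative
algebra \<open>F\<close> by an ideal \<open>K\<close>, namely the smallest ideal that contains the defining relations of the
envelope and all alternators of \<open>F\<close>. The theorem has two halves: the listed monomials span \<open>A\<close>, and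
there are enough homomorphisms out of \<open>A\<close> to separate their linear combinations. Once both are known,
an identity in \<open>A\<close> holds as soon as it holds under these homomorphisms, and the structure constants
are read off there.

Spanning. In \<open>A\<close> the Jacobian is six times the associator, so \<open>(a,b,c) = -d\<close> and
\<open>(a,x,c) = 0\<close> for \<open>x = d, e\<close>. Every alternative algebra satisfies
\<open>[x,y] \<circ> (x,y,z) = 0\<close>, where \<open>\<circ>\<close> is the Jordan product; this identity and its linearization at \<open>x = a\<close>, together with the
fact that \<open>b, c, d, e\<close> are eigenvectors of \<open>[a, _]\<close> for nonzero eigenvalues, force \<open>b, c, d, e\<close> to
annihilate \<open>d\<close>, and then to annihilate every \<open>a\<^sup>i d\<close>. The span of the \<open>a\<^sup>i d\<close> is
therefore stable under multiplication by the generators (\<open>gen_mul_D\<close>, \<open>D_mul_gen\<close>). Modulo this span,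
associators with two generators vanish on all monomials; this is an induction that rests on the skew
symmetry of the Kleinfeld function (\<open>gen_mul_tame\<close>). So modulo this span the left multiplications by
generators satisfy the relations of the Lie algebra \<open>M/Fd\<close>, and the straightening argument of Poincare,
Birkhoff and Witt shows that the span of all the listed monomials is stable under multiplication by
generators. Finally, left and right multiplication by a product \<open>xy\<close> are polynomials in the
multiplications by \<open>x\<close> and \<open>y\<close> (\<open>mul_left_product\<close>, \<open>mul_right_product\<close>), hence the span is all of \<open>A\<close>
(\<open>word_value_in_S\<close>).

Separation. Two alternative algebras receive homomorphisms from \<open>A\<close>. The first has elements
\<open>f + g b + h c + u bc + v d\<close> with coefficients that are functions of \<open>a\<close>, and kills \<open>b\<^sup>2\<close>, \<open>c\<^sup>2\<close>
and \<open>e\<close>; it sees the \<open>a\<^sup>i d\<close> and carries the correction terms \<open>T\<close>. The second is an associative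
algebra of operators on functions in which \<open>d\<close> acts as zero; it separates the \<open>a\<^sup>i b\<^sup>j c\<^sup>k e\<^sup>m\<close>.
Together they detect every nonzero element of \<open>A\<close> (\<open>in_proj_kernel_iff\<close>).
\<close>


section \<open>Quotients of nonassociative algebras\<close>

text \<open>
These laws make sum, product and scalar multiple of cosets of an ideal well defined, and they pass to
the quotient. The construction of a quotient can thus be iterated, first for the envelope and then for
its alternative quotient.
\<close>

locale distributive_algebra = abelian_group A for A :: "('k::field, 'v) module" (structure) +
  assumes mult_closed: "x \<in> carrier A \<Longrightarrow> y \<in> carrier A \<Longrightarrow> x \<otimes> y \<in> carrier A"
    and one_in_carrier: "\<one> \<in> carrier A"
    and smult_in_carrier: "x \<in> carrier A \<Longrightarrow> r \<odot> x \<in> carrier A"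
    and add_mult: "x \<in> carrier A \<Longrightarrow> y \<in> carrier A \<Longrightarrow> z \<in> carrier A \<Longrightarrow>
      (x \<oplus> y) \<otimes> z = x \<otimes> z \<oplus> y \<otimes> z"
    and mult_add: "x \<in> carrier A \<Longrightarrow> y \<in> carrier A \<Longrightarrow> z \<in> carrier A \<Longrightarrow>
      z \<otimes> (x \<oplus> y) = z \<otimes> x \<oplus> z \<otimes> y"
    and smult_add: "x \<in> carrier A \<Longrightarrow> y \<in> carrier A \<Longrightarrow> r \<odot> (x \<oplus> y) = r \<odot> x \<oplus> r \<odot> y"
begin

lemma mult_zero_carrier:
  assumes "x \<in> carrier A" shows "x \<otimes> \<zero> = \<zero>" "\<zero> \<otimes> x = \<zero>"
proof -
  have "x \<otimes> \<zero> \<oplus> x \<otimes> \<zero> = x \<otimes> \<zero> \<oplus> \<zero>"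
    using assms mult_add[of \<zero> \<zero> x] by (simp add: mult_closed)
  then show "x \<otimes> \<zero> = \<zero>" using assms by (simp add: mult_closed del: r_zero)
  have "\<zero> \<otimes> x \<oplus> \<zero> \<otimes> x = \<zero> \<otimes> x \<oplus> \<zero>"
    using assms add_mult[of \<zero> \<zero> x] by (simp add: mult_closed)
  then show "\<zero> \<otimes> x = \<zero>" using assms by (simp add: mult_closed del: r_zero)
qed

lemma smult_zero_carrier: "r \<odot> \<zero> = \<zero>"
proof -
  have "r \<odot> \<zero> \<oplus> r \<odot> \<zero> = r \<odot> \<zero> \<oplus> \<zero>"
    using smult_add[of \<zero> \<zero> r] by (simp add: smult_in_carrier)
  then show ?thesis by (simp add: smult_in_carrier del: r_zero)
qed

lemma associator_in_carrier:
  "x \<in> carrier A \<Longrightarrow> y \<in> carrier A \<Longrightarrow> z \<in> carrier A \<Longrightarrow> associator A x y z \<in> carrier A"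
  by (simp add: associator_def mult_closed)

end

lemma generated_ideal_superset: "W \<subseteq> generated_ideal A W"
  by (auto simp: generated_ideal_def)

lemma generated_ideal_minimal: "alg_ideal A I \<Longrightarrow> W \<subseteq> I \<Longrightarrow> generated_ideal A W \<subseteq> I"
  by (auto simp: generated_ideal_def)

context distributive_algebra
begin

lemma additive_subgroup_iff:
  "additive_subgroup I A \<longleftrightarrow> I \<subseteq> carrier A \<and> \<zero> \<in> I \<and> (\<forall>x\<in>I. \<forall>y\<in>I. x \<oplus> y \<in> I) \<and> (\<forall>x\<in>I. \<ominus> x \<in> I)"
  unfolding additive_subgroup_def subgroup_def a_inv_def by auto

lemma alg_ideal_iff:
  "alg_ideal A I \<longleftrightarrow> I \<subseteq> carrier A \<and> \<zero> \<in> I \<and> (\<forall>x\<in>I. \<forall>y\<in>I. x \<oplus> y \<in> I) \<and> (\<forall>x\<in>I. \<ominus> x \<in> I) \<and>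
     (\<forall>r. \<forall>x\<in>I. r \<odot> x \<in> I) \<and> (\<forall>x\<in>I. \<forall>y\<in>carrier A. x \<otimes> y \<in> I \<and> y \<otimes> x \<in> I)"
  by (auto simp: alg_ideal_def additive_subgroup_iff)

lemma alg_ideal_carrier: "alg_ideal A (carrier A)"
  by (simp add: alg_ideal_iff smult_in_carrier mult_closed)

lemma alg_ideal_generated:
  assumes "W \<subseteq> carrier A" shows "alg_ideal A (generated_ideal A W)"
proof -
  have "generated_ideal A W \<subseteq> carrier A"
    using assms by (intro generated_ideal_minimal alg_ideal_carrier)
  then show ?thesis
    unfolding alg_ideal_iff by (auto simp: generated_ideal_def alg_ideal_iff)
qed

context
  fixes I assumes ideal: "alg_ideal A I"
begin

lemma abelian_subgroup_ideal: "abelian_subgroup I A"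
  using ideal by (intro abelian_subgroupI3) (auto simp: alg_ideal_def abelian_group_axioms)

interpretation abelian_subgroup I A by (rule abelian_subgroup_ideal)

lemma coset_eq_iff:
  assumes "x \<in> carrier A" "y \<in> carrier A"
  shows "I +> x = I +> y \<longleftrightarrow> x \<ominus> y \<in> I"
proof
  assume "I +> x = I +> y"
  then have "I +> (x \<oplus> \<ominus> y) = I"
    using assms by (intro a_coset_add_inv2) auto
  then show "x \<ominus> y \<in> I"
    using assms a_rcos_self[of "x \<ominus> y"] by (simp add: minus_eq)
next
  assume "x \<ominus> y \<in> I"
  then have "I +> (x \<oplus> \<ominus> y) = I"
    using assms by (intro a_coset_join2) (auto simp: minus_eq a_subgroup)
  then show "I +> x = I +> y"
    using assms by (intro a_coset_add_inv1) auto
qed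

lemma coset_eq_zero_iff:
  assumes "x \<in> carrier A"
  shows "I +> x = I +> \<zero> \<longleftrightarrow> x \<in> I"
  using assms coset_eq_iff[of x \<zero>] minus_equality[of \<zero> \<zero>] by (simp add: minus_eq)

lemma coset_memD: "x \<in> carrier A \<Longrightarrow> y \<in> I +> x \<Longrightarrow> \<exists>h\<in>I. y = h \<oplus> x"
  by (auto simp: a_r_coset_def')

text \<open>
The product and the scalar multiples of cosets are unions over all representatives. Such a union
collapses once its members do not depend on the representative.
\<close>

lemma Union_coset:
  assumes "x \<in> carrier A" and "\<And>y. y \<in> I +> x \<Longrightarrow> F y = F x"
  shows "(\<Union>y\<in>I +> x. F y) = F x"
  using assms a_rcos_self[of x] by blast

lemma quotient_carrier: "carrier (quotient_algebra A I) = (\<lambda>x. I +> x) ` carrier A"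
  by (auto simp: quotient_algebra_def ring.defs module.defs FactRing_def A_RCOSETS_def' )

lemma quotient_zero: "\<zero>\<^bsub>quotient_algebra A I\<^esub> = I +> \<zero>"
  by (simp add: a_subset quotient_algebra_def ring.defs module.defs FactRing_def)

lemma quotient_one: "\<one>\<^bsub>quotient_algebra A I\<^esub> = I +> \<one>"
  by (simp add: quotient_algebra_def ring.defs module.defs FactRing_def)

lemma quotient_add:
  "x \<in> carrier A \<Longrightarrow> y \<in> carrier A \<Longrightarrow> (I +> x) \<oplus>\<^bsub>quotient_algebra A I\<^esub> (I +> y) = I +> (x \<oplus> y)"
  by (simp add: quotient_algebra_def ring.defs module.defs FactRing_def a_rcos_sum)

lemma I_closed: "x \<in> I \<Longrightarrow> r \<odot> x \<in> I" "x \<in> I \<Longrightarrow> y \<in> carrier A \<Longrightarrow> x \<otimes> y \<in> I"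
    "x \<in> I \<Longrightarrow> y \<in> carrier A \<Longrightarrow> y \<otimes> x \<in> I" "x \<in> I \<Longrightarrow> x \<in> carrier A"
  using ideal by (auto simp: alg_ideal_iff)

lemma coset_absorb: "h \<in> I \<Longrightarrow> x \<in> carrier A \<Longrightarrow> I +> (h \<oplus> x) = I +> x"
  by (subst coset_eq_iff) (auto simp: I_closed minus_eq a_assoc r_neg)

lemma quotient_smult:
  assumes x: "x \<in> carrier A"
  shows "r \<odot>\<^bsub>quotient_algebra A I\<^esub> (I +> x) = I +> (r \<odot> x)"
proof -
  have "(\<Union>y\<in>I +> x. I +> (r \<odot> y)) = I +> (r \<odot> x)"
    using x by (intro Union_coset) (auto dest!: coset_memD[OF x] simp: smult_add I_closed coset_absorb smult_in_carrier)
  then show ?thesis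
    by (simp add: quotient_algebra_def ring.defs module.defs FactRing_def)
qed

lemma quotient_mult:
  assumes x: "x \<in> carrier A" and y: "y \<in> carrier A"
  shows "(I +> x) \<otimes>\<^bsub>quotient_algebra A I\<^esub> (I +> y) = I +> (x \<otimes> y)"
proof -
  have *: "(\<Union>v\<in>I +> y. I +> (u \<otimes> v)) = I +> (u \<otimes> y)" if u: "u \<in> carrier A" for u
    using y u by (intro Union_coset) (auto dest!: coset_memD[OF y] simp: mult_add I_closed coset_absorb mult_closed)
  have "(\<Union>u\<in>I +> x. \<Union>v\<in>I +> y. I +> (u \<otimes> v)) = (\<Union>u\<in>I +> x. I +> (u \<otimes> y))"
    using * a_r_coset_subset_G[OF a_subset x] by (intro SUP_cong) auto
  also have "\<dots> = I +> (x \<otimes> y)"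
    using x y by (intro Union_coset) (auto dest!: coset_memD[OF x] simp: add_mult I_closed coset_absorb mult_closed)
  finally show ?thesis
    by (simp add: quotient_algebra_def ring.defs module.defs FactRing_def rcoset_mult_def)
qed

lemmas quotient_simps = quotient_add quotient_mult quotient_smult quotient_one quotient_zero

lemma quotient_distributive: "distributive_algebra (quotient_algebra A I)"
proof -
  let ?Q = "quotient_algebra A I"
  have "abelian_group ?Q"
  proof (rule abelian_groupI)
    fix X assume "X \<in> carrier ?Q"
    then obtain x where x: "x \<in> carrier A" "X = I +> x" by (auto simp: quotient_carrier)
    then have "(I +> \<ominus> x) \<oplus>\<^bsub>?Q\<^esub> X = \<zero>\<^bsub>?Q\<^esub>"
      by (simp add: quotient_simps l_neg)
    then show "\<exists>Y\<in>carrier ?Q. Y \<oplus>\<^bsub>?Q\<^esub> X = \<zero>\<^bsub>?Q\<^esub>"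
      using x by (auto simp: quotient_carrier intro!: bexI[of _ "I +> \<ominus> x"])
  qed (auto simp: quotient_carrier quotient_simps a_ac)
  moreover have "distributive_algebra_axioms ?Q"
    by standard (auto simp: quotient_carrier quotient_simps mult_closed smult_in_carrier one_in_carrier add_mult mult_add smult_add)
  ultimately show ?thesis by (rule distributive_algebra.intro)
qed

lemma quotient_associator:
  assumes "x \<in> carrier A" "y \<in> carrier A" "z \<in> carrier A"
  shows "associator (quotient_algebra A I) (I +> x) (I +> y) (I +> z) = I +> associator A x y z"
proof -
  interpret Q: distributive_algebra "quotient_algebra A I" by (rule quotient_distributive)
  have "(I +> x) \<ominus>\<^bsub>quotient_algebra A I\<^esub> (I +> y) = I +> (x \<ominus> y)" if "x \<in> carrier A" "y \<in> carrier A" for x y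
  proof -
    have "\<ominus>\<^bsub>quotient_algebra A I\<^esub> (I +> y) = I +> \<ominus> y"
      using that by (intro Q.minus_equality) (auto simp: quotient_simps quotient_carrier l_neg)
    then show ?thesis using that by (simp add: a_minus_def quotient_simps)
  qed
  then show ?thesis using assms by (simp add: associator_def quotient_mult mult_closed)
qed

text \<open>
Used to compare the alternator ideal, which lives in a quotient of the free algebra, with ideals of the
free algebra itself.
\<close>

lemma quotient_image_ideal:
  assumes J: "alg_ideal A J"
  shows "alg_ideal (quotient_algebra A I) ((\<lambda>x. I +> x) ` J)"
proof -
  interpret Q: distributive_algebra "quotient_algebra A I" by (rule quotient_distributive)
  have Jc: "x \<in> carrier A" if "x \<in> J" for x using J that by (auto simp: alg_ideal_iff)
  have "\<ominus>\<^bsub>quotient_algebra A I\<^esub> (I +> y) = I +> \<ominus> y" if "y \<in> carrier A" for y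
    using that by (intro Q.minus_equality) (auto simp: quotient_simps quotient_carrier l_neg)
  then show ?thesis
    using J unfolding Q.alg_ideal_iff alg_ideal_iff
    by (auto simp: quotient_carrier quotient_simps Jc)
qed

end
end


section \<open>The free nonassociative algebra\<close>

lemma vector_space_pm_scale: "vector_space pm_scale"
  by standard (auto intro!: poly_mapping_eqI simp: lookup_pm_scale lookup_add algebra_simps)

interpretation pm: vector_space pm_scale
  by (rule vector_space_pm_scale)

text \<open>
Brackets, products, the embedding of generators and the evaluation homomorphisms are all instances of
this map, so additivity and homogeneity need only one proof.
\<close>

definition linear_extension ::
    "('k::zero \<Rightarrow> 'v \<Rightarrow> 'v::comm_monoid_add) \<Rightarrow> ('i \<Rightarrow> 'v) \<Rightarrow> ('i \<Rightarrow>\<^sub>0 'k) \<Rightarrow> 'v" where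
  "linear_extension s f x = (\<Sum>i\<in>Poly_Mapping.keys x. s (Poly_Mapping.lookup x i) (f i))"

context vector_space
begin

lemma linear_extension_superset:
  assumes "finite I" "Poly_Mapping.keys x \<subseteq> I"
  shows "linear_extension scale f x = (\<Sum>i\<in>I. scale (Poly_Mapping.lookup x i) (f i))"
  unfolding linear_extension_def
  using assms by (intro sum.mono_neutral_left) (auto simp: in_keys_iff)

lemma linear_extension_zero [simp]: "linear_extension scale f 0 = 0"
  by (simp add: linear_extension_def)

lemma linear_extension_single [simp]:
  "linear_extension scale f (Poly_Mapping.single i r) = scale r (f i)"
  by (cases "r = 0") (simp_all add: linear_extension_def)

lemma linear_extension_add:
  "linear_extension scale f (x + y) = linear_extension scale f x + linear_extension scale f y"
proof -
  let ?I = "Poly_Mapping.keys x \<union> Poly_Mapping.keys y"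
  have "Poly_Mapping.keys (x + y) \<subseteq> ?I" by (rule Poly_Mapping.keys_add)
  then show ?thesis
    by (simp add: linear_extension_superset[of ?I] lookup_add scale_left_distrib sum.distrib)
qed

lemma linear_extension_scale:
  "linear_extension scale f (pm_scale r x) = scale r (linear_extension scale f x)"
proof -
  have "Poly_Mapping.keys (pm_scale r x) \<subseteq> Poly_Mapping.keys x"
    by (auto simp: in_keys_iff lookup_pm_scale)
  then show ?thesis
    by (simp add: linear_extension_superset[of "Poly_Mapping.keys x"] lookup_pm_scale scale_sum_right)
qed

lemma linear_extension_minus: "linear_extension scale f (- x) = - linear_extension scale f x"
  using linear_extension_add[of f x "- x"] by (simp add: eq_neg_iff_add_eq_0 add.commute)

lemma linear_extension_diff:
  "linear_extension scale f (x - y) = linear_extension scale f x - linear_extension scale f y"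
  using linear_extension_add[of f x "- y"] by (simp add: linear_extension_minus)

lemma linear_extension_sum:
  "linear_extension scale f (sum g I) = (\<Sum>i\<in>I. linear_extension scale f (g i))"
  by (induction I rule: infinite_finite_induct) (simp_all add: linear_extension_add)

end

lemma linear_extension_compose:
  fixes f :: "'i \<Rightarrow> 'v::comm_monoid_add" and F :: "'v \<Rightarrow> 'w::comm_monoid_add" and x :: "'i \<Rightarrow>\<^sub>0 'k::zero"
  assumes "F 0 = 0" "\<And>x y. F (x + y) = F x + F y" "\<And>r x. F (s r x) = s' r (F x)"
  shows "F (linear_extension s f x) = linear_extension s' (\<lambda>i. F (f i)) x"
proof -
  have "F (sum g I) = (\<Sum>i\<in>I. F (g i))" for g :: "'i \<Rightarrow> 'v" and I
    by (induction I rule: infinite_finite_induct) (simp_all add: assms)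
  then show ?thesis by (simp add: linear_extension_def assms(3))
qed

lemma linear_extension_pm_single:
  "linear_extension pm_scale (\<lambda>i. Poly_Mapping.single i 1) x = x"
proof (rule poly_mapping_eqI)
  fix j
  have "Poly_Mapping.lookup (linear_extension pm_scale (\<lambda>i. Poly_Mapping.single i 1) x) j =
      (\<Sum>i\<in>Poly_Mapping.keys x. if j = i then Poly_Mapping.lookup x i else 0)"
    unfolding linear_extension_def lookup_sum
    by (intro sum.cong) (auto simp: lookup_pm_scale lookup_single when_def)
  then show "Poly_Mapping.lookup (linear_extension pm_scale (\<lambda>i. Poly_Mapping.single i 1) x) j = Poly_Mapping.lookup x j"
    by (simp add: in_keys_iff)
qed

text \<open>
The two orders of summation exhibit a bilinear extension as linear in the first and in the second
argument, respectively.
\<close>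

lemma bilinear_extension_eq:
  "bilinear_extension B x y = linear_extension pm_scale (\<lambda>g. linear_extension pm_scale (B g) y) x"
  by (simp add: bilinear_extension_def linear_extension_def pm.scale_sum_right)

lemma bilinear_extension_eq':
  "bilinear_extension B x y = linear_extension pm_scale (\<lambda>h. linear_extension pm_scale (\<lambda>g. B g h) x) y"
  unfolding bilinear_extension_def linear_extension_def
  by (subst sum.swap) (simp add: pm.scale_sum_right mult.commute)

lemma bilinear_extension_add:
  "bilinear_extension B (x + x') y = bilinear_extension B x y + bilinear_extension B x' y"
  "bilinear_extension B x (y + y') = bilinear_extension B x y + bilinear_extension B x y'"
  by (simp add: bilinear_extension_eq pm.linear_extension_add)
     (simp add: bilinear_extension_eq' pm.linear_extension_add)

lemma bilinear_extension_scale: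
  "bilinear_extension B (pm_scale r x) y = pm_scale r (bilinear_extension B x y)"
  "bilinear_extension B x (pm_scale r y) = pm_scale r (bilinear_extension B x y)"
  by (simp add: bilinear_extension_eq pm.linear_extension_scale)
     (simp add: bilinear_extension_eq' pm.linear_extension_scale)

lemma bilinear_extension_single:
  "bilinear_extension B (Poly_Mapping.single g 1) (Poly_Mapping.single h 1) = B g h"
  by (simp add: bilinear_extension_eq)

abbreviation word :: "'g nword option \<Rightarrow> ('g, 'k::field) free" where
  "word w \<equiv> Poly_Mapping.single w 1"

abbreviation letter :: "'g \<Rightarrow> ('g, 'k::field) free" where
  "letter g \<equiv> word (Some (Letter g))"

definition free_mult :: "('g, 'k::field) free \<Rightarrow> ('g, 'k) free \<Rightarrow> ('g, 'k) free" (infixl "\<cdot>" 70) where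
  "x \<cdot> y = bilinear_extension (\<lambda>u v. word (word_mult u v)) x y"

lemma free_simps [simp]:
  "carrier free_algebra = UNIV" "x \<otimes>\<^bsub>free_algebra\<^esub> y = x \<cdot> y" "\<one>\<^bsub>free_algebra\<^esub> = word None"
  "\<zero>\<^bsub>free_algebra\<^esub> = 0" "x \<oplus>\<^bsub>free_algebra\<^esub> y = x + y" "r \<odot>\<^bsub>free_algebra\<^esub> x = pm_scale r x"
  by (simp_all add: free_algebra_def free_mult_def)

lemma free_mult_add: "(x + y) \<cdot> z = x \<cdot> z + y \<cdot> z" "x \<cdot> (y + z) = x \<cdot> y + x \<cdot> z"
  by (simp_all add: free_mult_def bilinear_extension_add)

lemma free_mult_scale: "pm_scale r x \<cdot> y = pm_scale r (x \<cdot> y)" "x \<cdot> pm_scale r y = pm_scale r (x \<cdot> y)"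
  by (simp_all add: free_mult_def bilinear_extension_scale)

lemma free_mult_zero [simp]: "x \<cdot> 0 = 0" "0 \<cdot> x = 0"
  using free_mult_scale(1)[of 0 x x] free_mult_scale(2)[of x 0 x] by simp_all

lemma free_mult_minus [simp]: "x \<cdot> (- y) = - (x \<cdot> y)" "(- x) \<cdot> y = - (x \<cdot> y)"
proof -
  have "x \<cdot> y + x \<cdot> (- y) = 0" "x \<cdot> y + (- x) \<cdot> y = 0" by (simp_all flip: free_mult_add)
  then show "x \<cdot> (- y) = - (x \<cdot> y)" "(- x) \<cdot> y = - (x \<cdot> y)"
    by (simp_all add: eq_neg_iff_add_eq_0 add.commute)
qed

lemma free_mult_diff: "(x - y) \<cdot> z = x \<cdot> z - y \<cdot> z" "x \<cdot> (y - z) = x \<cdot> y - x \<cdot> z"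
  using free_mult_add(1)[of x "- y" z] free_mult_add(2)[of x y "- z"] by simp_all

lemma word_mult_word: "word u \<cdot> word v = word (word_mult u v)"
  by (simp add: free_mult_def bilinear_extension_single)

lemma free_one [simp]: "word None \<cdot> x = x" "x \<cdot> word None = x"
proof -
  have [simp]: "word_mult w None = w" for w :: "'a nword option" by (cases w) simp_all
  show "word None \<cdot> x = x"
    by (simp add: free_mult_def bilinear_extension_eq linear_extension_pm_single)
  show "x \<cdot> word None = x"
    by (simp add: free_mult_def bilinear_extension_eq' linear_extension_pm_single)
qed

interpretation free: distributive_algebra "free_algebra :: ('k::field, ('g, 'k) free) module"
proof -
  have "abelian_group (free_algebra :: ('k, ('g, 'k) free) module)"
    by (rule abelian_groupI) (auto simp: algebra_simps intro: exI[of _ "- x" for x])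
  then show "distributive_algebra (free_algebra :: ('k, ('g, 'k) free) module)"
    by (auto simp: distributive_algebra_def distributive_algebra_axioms_def free_mult_add pm.scale_right_distrib)
qed

lemma free_a_inv [simp]: "\<ominus>\<^bsub>free_algebra\<^esub> x = - x"
  by (rule free.minus_equality) simp_all

lemma free_a_minus [simp]: "x \<ominus>\<^bsub>free_algebra\<^esub> y = x - y"
  by (simp add: a_minus_def)

lemma free_associator: "associator free_algebra x y z = (x \<cdot> y) \<cdot> z - x \<cdot> (y \<cdot> z)"
  by (simp add: associator_def)

lemma embed_eq: fixes x :: "'g \<Rightarrow>\<^sub>0 'k::field" shows "embed x = linear_extension pm_scale letter x"
proof -
  have "Poly_Mapping.single w r = pm_scale r (word w)" for w :: "'g nword option" and r :: 'k
    by (rule poly_mapping_eqI) (simp add: lookup_pm_scale lookup_single when_def)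
  then show ?thesis unfolding embed_def linear_extension_def by metis
qed

lemma embed_single: "embed (Poly_Mapping.single g 1) = letter g"
  by (simp add: embed_eq)

lemma free_ideal_iff:
  "alg_ideal free_algebra I \<longleftrightarrow> 0 \<in> I \<and> (\<forall>x\<in>I. \<forall>y\<in>I. x + y \<in> I) \<and> (\<forall>r. \<forall>x\<in>I. pm_scale r x \<in> I) \<and>
     (\<forall>x\<in>I. \<forall>y. x \<cdot> y \<in> I \<and> y \<cdot> x \<in> I)"
proof -
  have "- x = pm_scale (- 1) x" for x :: "('a, 'b) free" by simp
  then show ?thesis unfolding free.alg_ideal_iff by (simp del: pm.scale_minus_left) blast
qed


section \<open>The alternative envelope as a quotient of the free algebra\<close>

text \<open>
The composite of the two quotient maps, from the free algebra to the envelope and on to its alternative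
quotient.
\<close>

definition proj :: "('g, 'k::field) bracket \<Rightarrow> ('g, 'k) free \<Rightarrow> ('g, 'k) free set set" where
  "proj br x = alternator_ideal br +>\<^bsub>envelope br\<^esub> (envelope_ideal br +>\<^bsub>free_algebra\<^esub> x)"

definition proj_kernel :: "('g, 'k::field) bracket \<Rightarrow> ('g, 'k) free set" where
  "proj_kernel br = {x. proj br x = \<zero>\<^bsub>alt_envelope br\<^esub>}"

context
  fixes br :: "('g, 'k::field) bracket"
begin

lemma envelope_ideal: "alg_ideal free_algebra (envelope_ideal br)"
  unfolding envelope_ideal_def by (rule free.alg_ideal_generated) simp

interpretation E: distributive_algebra "envelope br"
  unfolding envelope_def by (rule free.quotient_distributive[OF envelope_ideal])

lemmas envelope_simps =
  free.quotient_carrier[OF envelope_ideal, folded envelope_def, simplified]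
  free.quotient_simps[OF envelope_ideal, folded envelope_def, simplified]

lemma alternator_ideal: "alg_ideal (envelope br) (alternator_ideal br)"
  unfolding alternator_ideal_def
  by (rule E.alg_ideal_generated) (auto intro: E.associator_in_carrier)

lemma alt_envelope_distributive: "distributive_algebra (alt_envelope br)"
  unfolding alt_envelope_def by (rule E.quotient_distributive[OF alternator_ideal])

interpretation A: distributive_algebra "alt_envelope br"
  by (rule alt_envelope_distributive)

lemma alt_envelope_carrier: "carrier (alt_envelope br) = range (proj br)"
  unfolding proj_def E.quotient_carrier[OF alternator_ideal, folded alt_envelope_def] envelope_simps
  by auto

lemma proj_simps:
  "proj br x \<oplus>\<^bsub>alt_envelope br\<^esub> proj br y = proj br (x + y)"
  "proj br x \<otimes>\<^bsub>alt_envelope br\<^esub> proj br y = proj br (x \<cdot> y)"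
  "r \<odot>\<^bsub>alt_envelope br\<^esub> proj br x = proj br (pm_scale r x)"
  "\<one>\<^bsub>alt_envelope br\<^esub> = proj br (word None)"
  "\<zero>\<^bsub>alt_envelope br\<^esub> = proj br 0"
  by (simp_all add: proj_def E.quotient_simps[OF alternator_ideal, folded alt_envelope_def] envelope_simps)

lemma proj_sum: "finsum (alt_envelope br) (\<lambda>i. proj br (f i)) I = proj br (sum f I)" if "finite I"
  using that
proof (induction I rule: finite_induct)
  case empty then show ?case by (simp add: proj_simps)
next
  case (insert i I)
  then show ?case by (subst A.finsum_insert) (auto simp: alt_envelope_carrier proj_simps)
qed

lemma proj_kernel_ideal: "alg_ideal free_algebra (proj_kernel br)"
proof -
  have c: "proj br x \<in> carrier (alt_envelope br)" for x by (simp add: alt_envelope_carrier)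
  have "proj br 0 = \<zero>\<^bsub>alt_envelope br\<^esub>"
    and "proj br (x + y) = proj br x \<oplus>\<^bsub>alt_envelope br\<^esub> proj br y"
    and "proj br (pm_scale r x) = r \<odot>\<^bsub>alt_envelope br\<^esub> proj br x"
    and "proj br (x \<cdot> y) = proj br x \<otimes>\<^bsub>alt_envelope br\<^esub> proj br y" for x y r
    by (simp_all only: proj_simps)
  then show ?thesis
    unfolding free_ideal_iff proj_kernel_def
    using A.mult_zero_carrier[OF c] A.smult_zero_carrier by simp
qed

lemma proj_eq_iff: "proj br x = proj br y \<longleftrightarrow> x - y \<in> proj_kernel br"
proof
  have "proj br (x - y) = proj br x \<oplus>\<^bsub>alt_envelope br\<^esub> proj br (- y)" by (simp only: proj_simps) simp
  also assume "proj br x = proj br y"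
  also have "proj br y \<oplus>\<^bsub>alt_envelope br\<^esub> proj br (- y) = \<zero>\<^bsub>alt_envelope br\<^esub>"
    by (simp only: proj_simps) simp
  finally show "x - y \<in> proj_kernel br" by (simp add: proj_kernel_def)
next
  assume "x - y \<in> proj_kernel br"
  have "proj br x = proj br (x - y) \<oplus>\<^bsub>alt_envelope br\<^esub> proj br y" by (simp only: proj_simps) simp
  also have "proj br (x - y) = \<zero>\<^bsub>alt_envelope br\<^esub>"
    using \<open>x - y \<in> proj_kernel br\<close> by (simp add: proj_kernel_def)
  also have "\<zero>\<^bsub>alt_envelope br\<^esub> \<oplus>\<^bsub>alt_envelope br\<^esub> proj br y = proj br y"
    by (rule A.l_zero) (simp add: alt_envelope_carrier)
  finally show "proj br x = proj br y" .
qed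

lemma coset_in_alternator_ideal_iff:
  "envelope_ideal br +>\<^bsub>free_algebra\<^esub> x \<in> alternator_ideal br \<longleftrightarrow> x \<in> proj_kernel br"
proof -
  have c: "envelope_ideal br +>\<^bsub>free_algebra\<^esub> x \<in> carrier (envelope br)" by (simp add: envelope_simps(1))
  have z: "envelope_ideal br +>\<^bsub>free_algebra\<^esub> 0 = \<zero>\<^bsub>envelope br\<^esub>" by (simp add: envelope_simps)
  have "x \<in> proj_kernel br \<longleftrightarrow> proj br x = proj br 0" by (simp only: proj_eq_iff diff_zero)
  also have "\<dots> \<longleftrightarrow> envelope_ideal br +>\<^bsub>free_algebra\<^esub> x \<in> alternator_ideal br"
    unfolding proj_def z by (rule E.coset_eq_zero_iff[OF alternator_ideal c])
  finally show ?thesis ..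
qed

lemma envelope_ideal_subset_kernel: "envelope_ideal br \<subseteq> proj_kernel br"
proof
  fix x assume "x \<in> envelope_ideal br"
  then have "envelope_ideal br +>\<^bsub>free_algebra\<^esub> x = envelope_ideal br +>\<^bsub>free_algebra\<^esub> 0"
    using free.coset_eq_zero_iff[OF envelope_ideal, of x] by simp
  then have "proj br x = proj br 0" by (simp only: proj_def)
  then show "x \<in> proj_kernel br" by (simp only: proj_eq_iff diff_zero)
qed

lemma envelope_relations_subset_kernel: "envelope_relations br \<subseteq> proj_kernel br"
  using generated_ideal_superset[of "envelope_relations br" free_algebra] envelope_ideal_subset_kernel
  unfolding envelope_ideal_def by (rule subset_trans)

text \<open>
The free algebra maps onto the envelope, so its alternators map to alternators of the envelope.
\<close>

lemma alternator_in_kernel: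
  "(x \<cdot> x) \<cdot> y - x \<cdot> (x \<cdot> y) \<in> proj_kernel br" "(y \<cdot> x) \<cdot> x - y \<cdot> (x \<cdot> x) \<in> proj_kernel br"
proof -
  let ?c = "\<lambda>x. envelope_ideal br +>\<^bsub>free_algebra\<^esub> x"
  have ass: "associator (envelope br) (?c u) (?c v) (?c w) = ?c ((u \<cdot> v) \<cdot> w - u \<cdot> (v \<cdot> w))" for u v w
    using free.quotient_associator[OF envelope_ideal, of u v w] by (simp add: envelope_def free_associator)
  have c: "?c u \<in> carrier (envelope br)" for u by (simp add: envelope_simps(1))
  have "associator (envelope br) u u v \<in> alternator_ideal br \<and> associator (envelope br) v u u \<in> alternator_ideal br"
    if "u \<in> carrier (envelope br)" "v \<in> carrier (envelope br)" for u v
    unfolding alternator_ideal_def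
    using that by (intro conjI subsetD[OF generated_ideal_superset]) blast+
  from this[OF c c] have "?c ((x \<cdot> x) \<cdot> y - x \<cdot> (x \<cdot> y)) \<in> alternator_ideal br"
    "?c ((y \<cdot> x) \<cdot> x - y \<cdot> (x \<cdot> x)) \<in> alternator_ideal br"
    by (simp_all only: ass)
  then show "(x \<cdot> x) \<cdot> y - x \<cdot> (x \<cdot> y) \<in> proj_kernel br" "(y \<cdot> x) \<cdot> x - y \<cdot> (x \<cdot> x) \<in> proj_kernel br"
    by (simp_all only: coset_in_alternator_ideal_iff)
qed

text \<open>
The universal property of the alternative envelope, stated for kernels: \<open>L\<close> contains the ideal of the
envelope relations, and its image in the envelope is an ideal that contains all alternators.
\<close>

lemma proj_kernel_minimal:
  assumes L: "alg_ideal free_algebra L"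
    and rel: "envelope_relations br \<subseteq> L"
    and alt: "\<And>x y. (x \<cdot> x) \<cdot> y - x \<cdot> (x \<cdot> y) \<in> L" "\<And>x y. (y \<cdot> x) \<cdot> x - y \<cdot> (x \<cdot> x) \<in> L"
  shows "proj_kernel br \<subseteq> L"
proof
  fix x assume x: "x \<in> proj_kernel br"
  let ?c = "\<lambda>x. envelope_ideal br +>\<^bsub>free_algebra\<^esub> x"
  have IL: "envelope_ideal br \<subseteq> L"
    unfolding envelope_ideal_def by (rule generated_ideal_minimal[OF L rel])
  have "alg_ideal (envelope br) (?c ` L)"
    unfolding envelope_def by (rule free.quotient_image_ideal[OF envelope_ideal L])
  moreover have "associator (envelope br) (?c u) (?c v) (?c w) = ?c ((u \<cdot> v) \<cdot> w - u \<cdot> (v \<cdot> w))" for u v w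
    using free.quotient_associator[OF envelope_ideal, of u v w] by (simp add: envelope_def free_associator)
  ultimately have "alternator_ideal br \<subseteq> ?c ` L"
    unfolding alternator_ideal_def
    by (intro generated_ideal_minimal) (auto simp: envelope_simps(1) alt)
  moreover have "?c x \<in> alternator_ideal br"
    using x by (simp add: coset_in_alternator_ideal_iff)
  ultimately obtain y where y: "y \<in> L" "?c x = ?c y" by blast
  then have "x - y \<in> envelope_ideal br"
    using free.coset_eq_iff[OF envelope_ideal, of x y] by simp
  then have "x - y \<in> L" using IL by blast
  moreover have "u \<in> L \<Longrightarrow> v \<in> L \<Longrightarrow> u + v \<in> L" for u v
    using L by (auto simp: free_ideal_iff)
  ultimately have "(x - y) + y \<in> L" using y(1) by blast
  then show "x \<in> L" by simp
qed

end


section \<open>Identities of alternative algebras\<close>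

locale alternative_algebra = vector_space scale
  for scale :: "'k::field_char_0 \<Rightarrow> 'v::ab_group_add \<Rightarrow> 'v" +
  fixes mul :: "'v \<Rightarrow> 'v \<Rightarrow> 'v"  (infixl "\<star>" 70)
  assumes add_mul: "(x + y) \<star> z = x \<star> z + y \<star> z"
    and mul_add: "x \<star> (y + z) = x \<star> y + x \<star> z"
    and scale_mul: "scale r x \<star> y = scale r (x \<star> y)"
    and mul_scale: "x \<star> scale r y = scale r (x \<star> y)"
    and left_alternative: "(x \<star> x) \<star> y = x \<star> (x \<star> y)"
    and right_alternative: "(y \<star> x) \<star> x = y \<star> (x \<star> x)"
begin

lemma mul_zero [simp]: "x \<star> 0 = 0" "0 \<star> x = 0"
  using mul_add[of x 0 0] add_mul[of 0 0 x] by simp_all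

lemma mul_minus [simp]: "x \<star> (- y) = - (x \<star> y)" "(- x) \<star> y = - (x \<star> y)"
proof -
  have "x \<star> y + x \<star> (- y) = 0" by (simp flip: mul_add)
  then show "x \<star> (- y) = - (x \<star> y)" by (simp add: eq_neg_iff_add_eq_0 add.commute)
  have "x \<star> y + (- x) \<star> y = 0" by (simp flip: add_mul)
  then show "(- x) \<star> y = - (x \<star> y)" by (simp add: eq_neg_iff_add_eq_0 add.commute)
qed

lemma mul_diff: "x \<star> (y - z) = x \<star> y - x \<star> z" "(x - y) \<star> z = x \<star> z - y \<star> z"
  using mul_add[of x y "- z"] add_mul[of x "- y" z] by simp_all

lemmas mul_distribs = add_mul mul_add mul_diff

lemma scale_two: "scale 2 x = x + x"
  using scale_left_distrib[of 1 1 x] by simp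

lemma double_eq_0: "x + x = 0 \<Longrightarrow> x = (0::'v)"
  using scale_eq_0_iff[of 2 x] by (simp add: scale_two)

lemma self_eq_minus: "x = - x \<Longrightarrow> x = (0::'v)"
  by (rule double_eq_0) (metis add.right_inverse)

lemma triple_eq_0: "x + x + x = 0 \<Longrightarrow> x = (0::'v)"
  using scale_eq_0_iff[of 3 x] scale_left_distrib[of 2 1 x] by (simp add: scale_two)

definition ass :: "'v \<Rightarrow> 'v \<Rightarrow> 'v \<Rightarrow> 'v" where
  "ass x y z = (x \<star> y) \<star> z - x \<star> (y \<star> z)"

lemma ass_add: "ass (x + x') y z = ass x y z + ass x' y z"
    "ass x (y + y') z = ass x y z + ass x y' z"
    "ass x y (z + z') = ass x y z + ass x y z'"
  by (simp_all add: ass_def mul_distribs)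

lemma ass_minus [simp]: "ass (- x) y z = - ass x y z" "ass x (- y) z = - ass x y z"
    "ass x y (- z) = - ass x y z"
  by (simp_all add: ass_def)

lemma ass_diff: "ass (x - x') y z = ass x y z - ass x' y z"
  by (simp_all add: ass_def mul_distribs)

lemma ass_scale: "ass (scale r x) y z = scale r (ass x y z)"
    "ass x (scale r y) z = scale r (ass x y z)"
    "ass x y (scale r z) = scale r (ass x y z)"
  by (simp_all add: ass_def scale_mul mul_scale scale_right_diff_distrib)

lemma ass_same [simp]: "ass x x y = 0" "ass y x x = 0"
  by (simp_all add: ass_def left_alternative right_alternative)

lemma ass_swap12: "ass y x z = - ass x y z"
  using ass_same(1)[of "x + y" z] by (simp add: ass_add del: ass_same(1)) (simp add: eq_neg_iff_add_eq_0)

lemma ass_swap23: "ass x z y = - ass x y z"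
  using ass_same(2)[of x "y + z"] by (simp add: ass_add del: ass_same(2)) (simp add: eq_neg_iff_add_eq_0)

lemma ass_rotate: "ass y z x = ass x y z"
  using ass_swap12[of x y z] ass_swap23[of y x z] by simp

lemma ass_swap13: "ass z y x = - ass x y z"
  using ass_swap12[of y z x] ass_rotate[of y z x] by simp

lemma flexible: "(x \<star> y) \<star> x = x \<star> (y \<star> x)"
  using ass_swap12[of x y x] by (simp add: ass_def left_alternative right_alternative)

text \<open>
By the cyclic symmetry of the associator, multiplication by \<open>x \<star> y\<close> on either side is expressed through
multiplications by \<open>x\<close> and by \<open>y\<close>. Therefore a subspace that is stable under left and right
multiplication by generators is stable under multiplication by everything they generate.
\<close>

lemma mul_left_product: "(x \<star> y) \<star> z = x \<star> (y \<star> z) + ((y \<star> z) \<star> x - y \<star> (z \<star> x))"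
  using ass_rotate[of y z x] by (simp add: ass_def algebra_simps)

lemma mul_right_product: "z \<star> (x \<star> y) = (z \<star> x) \<star> y - ((y \<star> z) \<star> x - y \<star> (z \<star> x))"
  using ass_rotate[of z x y] by (simp add: ass_def algebra_simps)

text \<open>
The Kleinfeld function. It is skew symmetric in all four arguments, which turns statements about
associators of products into statements about associators of their factors.
\<close>

definition kleinfeld :: "'v \<Rightarrow> 'v \<Rightarrow> 'v \<Rightarrow> 'v \<Rightarrow> 'v" where
  "kleinfeld w x y z = ass (w \<star> x) y z - x \<star> ass w y z - ass x y z \<star> w"

lemma kleinfeld_swap34: "kleinfeld w x z y = - kleinfeld w x y z"
  by (simp add: kleinfeld_def ass_swap23[of _ y z])

lemma teichmueller:
  "ass (w \<star> x) y z - ass w (x \<star> y) z + ass w x (y \<star> z) = w \<star> ass x y z + ass w x y \<star> z"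
  by (simp add: ass_def mul_distribs)

text \<open>
The identity of Teichmueller, with its associators rotated into a common cyclic order. The right-hand
side changes sign under a cyclic shift of the arguments; adding the shifted identity leaves only two
terms and gives \<open>kleinfeld_rotate\<close>.
\<close>

lemma kleinfeld_alternating_sum:
  "kleinfeld w x y z - kleinfeld x y z w + kleinfeld y z w x =
    (w \<star> ass x y z - ass x y z \<star> w) - (x \<star> ass y z w - ass y z w \<star> x)
    + (y \<star> ass z w x - ass z w x \<star> y) - (z \<star> ass w x y - ass w x y \<star> z)"
proof -
  have "ass w (x \<star> y) z = ass (x \<star> y) z w" "ass w x (y \<star> z) = ass (y \<star> z) w x"
    by (simp_all add: ass_rotate)
  then have *: "ass (w \<star> x) y z - ass (x \<star> y) z w + ass (y \<star> z) w x
      = w \<star> ass x y z + ass w x y \<star> z"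
    using teichmueller[of w x y z] by simp
  have s: "ass w y z = ass y z w" "ass x z w = ass z w x" "ass y w x = ass w x y"
    by (simp_all add: ass_rotate)
  have "kleinfeld w x y z - kleinfeld x y z w + kleinfeld y z w x =
     (ass (w \<star> x) y z - ass (x \<star> y) z w + ass (y \<star> z) w x)
     - x \<star> ass y z w - ass x y z \<star> w + y \<star> ass z w x + ass y z w \<star> x
     - z \<star> ass w x y - ass z w x \<star> y"
    unfolding kleinfeld_def s by (simp add: algebra_simps)
  then show ?thesis
    unfolding * by (simp add: algebra_simps)
qed

lemma kleinfeld_rotate: "kleinfeld z w x y = - kleinfeld w x y z"
proof -
  have "kleinfeld w x y z + kleinfeld z w x y =
      (kleinfeld w x y z - kleinfeld x y z w + kleinfeld y z w x)
      + (kleinfeld x y z w - kleinfeld y z w x + kleinfeld z w x y)"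
    by simp
  also have "\<dots> = 0"
    unfolding kleinfeld_alternating_sum by (simp add: algebra_simps)
  finally show ?thesis
    by (simp add: eq_neg_iff_add_eq_0 add.commute)
qed

lemma kleinfeld_swap_pairs: "kleinfeld y z w x = kleinfeld w x y z"
  using kleinfeld_rotate[of y z w x] kleinfeld_rotate[of z w x y] by simp

lemma kleinfeld_swap12: "kleinfeld x w y z = - kleinfeld w x y z"
  using kleinfeld_swap_pairs[of x w y z] kleinfeld_swap_pairs[of w x y z] kleinfeld_swap34[of y z w x]
  by simp

lemma kleinfeld_swap23: "kleinfeld w y x z = - kleinfeld w x y z"
  using kleinfeld_rotate[of z w y x] kleinfeld_rotate[of z w x y] kleinfeld_swap34[of z w x y]
  by simp

text \<open>
Evaluates the Kleinfeld function where commutators of the first two arguments are under control, as for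
elements of a Lie or Malcev algebra.
\<close>

lemma kleinfeld_commutator:
  "kleinfeld w x y z + kleinfeld w x y z = ass (w \<star> x - x \<star> w) y z
     + (w \<star> ass x y z - ass x y z \<star> w) - (x \<star> ass w y z - ass w y z \<star> x)"
proof -
  have "kleinfeld w x y z + kleinfeld w x y z = kleinfeld w x y z - kleinfeld x w y z"
    by (simp add: kleinfeld_swap12[of x w])
  then show ?thesis by (simp add: kleinfeld_def ass_diff algebra_simps)
qed

lemma ass_product_same1: "ass (x \<star> y) y z = y \<star> ass x y z"
proof -
  have "kleinfeld x y y z = 0"
    by (rule self_eq_minus) (rule kleinfeld_swap23)
  then show ?thesis by (simp add: kleinfeld_def)
qed

lemma ass_product_same2: "ass (x \<star> y) x z = - (ass x y z \<star> x)"
proof -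
  have "kleinfeld y x x z = 0"
    by (rule self_eq_minus) (rule kleinfeld_swap23)
  then have "kleinfeld x y x z = 0" using kleinfeld_swap12[of x y x z] by simp
  then show ?thesis by (simp add: kleinfeld_def ass_swap12[of y x] add_eq_0_iff2)
qed

lemma kleinfeld_product: "kleinfeld x y (x \<star> y) z = ass y (ass x y z) x"
proof -
  have "kleinfeld x y (x \<star> y) z = y \<star> ass (x \<star> y) x z + ass (x \<star> y) y z \<star> x"
    by (simp add: kleinfeld_def ass_swap12[of "x \<star> y" x] ass_swap12[of "x \<star> y" y])
  then show ?thesis
    by (simp add: ass_product_same1 ass_product_same2) (simp add: ass_def)
qed

text \<open>
The associator of \<open>(xy)x = x(yx)\<close> with \<open>y\<close> and \<open>z\<close> is
computed in two ways: once by splitting off the factor \<open>x\<close> on the right, once on the left. Both Kleinfeld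
terms reduce by skew symmetry to \<open>(y, (x, y, z), x)\<close>, and the rest is the claim.
\<close>

lemma commutator_jordan_associator:
  "(x \<star> y - y \<star> x) \<star> ass x y z + ass x y z \<star> (x \<star> y - y \<star> x) = 0"
proof -
  define D where "D = ass x y z"
  have D': "ass y x z = - D" by (simp add: D_def ass_swap12[of y x])
  \<comment> \<open>the two Kleinfeld terms, for \<open>(xy)x\<close> and for \<open>x(yx)\<close>\<close>
  have "kleinfeld (x \<star> y) x y z = kleinfeld x y (x \<star> y) z"
    using kleinfeld_swap12[of "x \<star> y" x y z] kleinfeld_swap23[of x y "x \<star> y" z] by simp
  then have 1: "kleinfeld (x \<star> y) x y z = ass y D x"
    by (simp add: kleinfeld_product D_def)
  have "kleinfeld x (y \<star> x) y z = kleinfeld y x (y \<star> x) z"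
    using kleinfeld_swap12[of x "y \<star> x" y z] kleinfeld_swap12[of y x "y \<star> x" z]
      kleinfeld_swap23[of x "y \<star> x" y z] by simp
  then have 2: "kleinfeld x (y \<star> x) y z = ass y D x"
    by (simp add: kleinfeld_product D' ass_swap13[of y D x])
  have "ass (y \<star> x) y z = D \<star> y"
    using ass_product_same2[of y x z] by (simp add: D')
  then have "ass (x \<star> (y \<star> x)) y z = ass y D x + (y \<star> x) \<star> D + (D \<star> y) \<star> x"
    using 2 by (simp add: kleinfeld_def D_def[symmetric] algebra_simps)
  moreover have "ass ((x \<star> y) \<star> x) y z = ass y D x + x \<star> (y \<star> D) + D \<star> (x \<star> y)"
    using 1 by (simp add: kleinfeld_def D_def[symmetric] ass_product_same1 algebra_simps)
  ultimately have 3: "(y \<star> x) \<star> D + (D \<star> y) \<star> x = x \<star> (y \<star> D) + D \<star> (x \<star> y)"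
    by (simp add: flexible algebra_simps)
  have "ass D y x = - ass x y D"
    by (rule ass_swap13)
  then have "(D \<star> y) \<star> x - D \<star> (y \<star> x) = x \<star> (y \<star> D) - (x \<star> y) \<star> D"
    by (simp add: ass_def)
  then have "(D \<star> y) \<star> x = D \<star> (y \<star> x) + x \<star> (y \<star> D) - (x \<star> y) \<star> D"
    by (simp add: algebra_simps)
  with 3 have "(y \<star> x) \<star> D + D \<star> (y \<star> x) = (x \<star> y) \<star> D + D \<star> (x \<star> y)"
    by (simp add: algebra_simps)
  then show ?thesis by (simp add: D_def[symmetric] mul_diff algebra_simps)
qed

lemma commutator_jordan_associator_linearized:
  "(x \<star> y - y \<star> x) \<star> ass x y' z + ass x y' z \<star> (x \<star> y - y \<star> x)
   + ((x \<star> y' - y' \<star> x) \<star> ass x y z + ass x y z \<star> (x \<star> y' - y' \<star> x)) = 0"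
    (is "?l = 0")
proof -
  define h where "h u v = (x \<star> u - u \<star> x) \<star> ass x v z + ass x v z \<star> (x \<star> u - u \<star> x)" for u v
  have "h (y + y') (y + y') = h y y + h y' y' + (h y y' + h y' y)"
    by (simp add: h_def ass_add mul_distribs algebra_simps)
  moreover have "h u u = 0" for u by (simp add: h_def commutator_jordan_associator)
  ultimately show ?thesis by (simp add: h_def)
qed

text \<open>
In every algebra the Jacobian is the alternating sum of the associators of the six permutations of its
arguments; in an alternative algebra these six terms coincide.
\<close>

lemma jacobian_eq_associator:
  assumes "com = (\<lambda>x y. x \<star> y - y \<star> x)"
  shows "com (com x y) z + com (com y z) x + com (com z x) y = scale 6 (ass x y z)"
proof -
  have "scale 6 v = v + v + v + v + v + v" for v
    using scale_left_distrib[of 1 1 v] scale_left_distrib[of 2 2 v] scale_left_distrib[of 4 2 v]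
    by (simp add: add.assoc)
  moreover have "com (com x y) z + com (com y z) x + com (com z x) y =
      ass x y z + ass y z x + ass z x y - ass y x z - ass x z y - ass z y x"
    by (simp add: assms ass_def mul_distribs algebra_simps)
  ultimately show ?thesis
    by (simp add: ass_rotate[of y z x] ass_rotate[of z x y] ass_swap12[of y x] ass_swap23[of x z y] ass_swap13[of z y x])
qed

end


section \<open>Alternative algebras generated by the five basis vectors\<close>

lemma sum_gen: "(\<Sum>x\<in>UNIV. f x) = f Ga + f Gb + f Gc + f Gd + (f Ge :: 'a::comm_monoid_add)"
  by (simp add: UNIV_gen add.assoc)

text \<open>
The unit laws are restricted to generators and products, because the locale is used for the product
\<open>p (x y)\<close> on the free algebra, where \<open>p\<close> is a projection along an ideal: there the image of the unit is
neutral on the image of \<open>p\<close> only.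
\<close>

locale malcev_generators = alternative_algebra scale mul
  for scale :: "'k::field_char_0 \<Rightarrow> 'v::ab_group_add \<Rightarrow> 'v" and mul (infixl "\<star>" 70) +
  fixes \<gamma> :: 'k and G :: "gen \<Rightarrow> 'v" and one :: 'v
  assumes gamma_nz: "\<gamma> \<noteq> 0"
    and commutator: "G g \<star> G h - G h \<star> G g =
      (\<Sum>x\<in>UNIV. scale (Poly_Mapping.lookup (gen_bracket \<gamma> g h) x) (G x))"
    and one_gen: "one \<star> G g = G g" "G g \<star> one = G g"
    and one_product: "one \<star> (x \<star> y) = x \<star> y" "(x \<star> y) \<star> one = x \<star> y"
begin

abbreviation "a \<equiv> G Ga"
abbreviation "b \<equiv> G Gb"
abbreviation "c \<equiv> G Gc"
abbreviation "d \<equiv> G Gd"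
abbreviation "e \<equiv> G Ge"

lemma commutators:
  "a \<star> b - b \<star> a = - b" "a \<star> c - c \<star> a = - c" "a \<star> d - d \<star> a = d"
  "a \<star> e - e \<star> a = scale \<gamma> e" "b \<star> c - c \<star> b = scale 2 d" "b \<star> d - d \<star> b = 0"
  "b \<star> e - e \<star> b = 0" "c \<star> d - d \<star> c = 0" "c \<star> e - e \<star> c = 0" "d \<star> e - e \<star> d = 0"
  by (simp_all add: commutator sum_gen lookup_single)

lemma commuting: "d \<star> b = b \<star> d" "e \<star> b = b \<star> e" "d \<star> c = c \<star> d" "e \<star> c = c \<star> e" "e \<star> d = d \<star> e"
  using commutators by simp_all

lemma a_left: "b \<star> a = a \<star> b + b" "c \<star> a = a \<star> c + c" "d \<star> a = a \<star> d - d"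
    "e \<star> a = a \<star> e - scale \<gamma> e" "c \<star> b = b \<star> c - scale 2 d"
  using commutators by (simp_all add: algebra_simps)

lemma ass_a_b_c: "ass a b c = - d"
proof -
  have "scale 6 (ass a b c) = - scale 6 d"
    unfolding jacobian_eq_associator[OF refl, symmetric]
    using scale_left_distrib[of 2 2 d] scale_left_distrib[of 4 2 d]
    by (simp add: a_left mul_distribs scale_mul mul_scale scale_right_diff_distrib)
  then have "scale 6 (ass a b c) = scale 6 (- d)" by simp
  then show ?thesis by (simp only: scale_left_imp_eq scale_cancel_left) simp
qed

lemma ass_a_x_c_0: "ass a d c = 0" "ass a e c = 0"
proof -
  have "scale 6 (ass a d c) = 0" "scale 6 (ass a e c) = 0"
    unfolding jacobian_eq_associator[OF refl, symmetric]
    by (simp_all add: a_left commuting mul_distribs scale_mul mul_scale)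
  then show "ass a d c = 0" "ass a e c = 0" by simp_all
qed

text \<open>
Take \<open>x\<close> among \<open>b\<close>, \<open>d\<close>, \<open>e\<close>. Since \<open>(a, b, c) = -d\<close>, the identity for \<open>[a, x] \<circ> (a, b, c)\<close> and its linearization give
\<open>[a, x] \<circ> d = 0\<close>; for \<open>c\<close> the roles of \<open>b\<close> and \<open>c\<close> are exchanged. As \<open>[a, x]\<close> is a nonzero multiple of \<open>x\<close> and
\<open>x\<close> commutes with \<open>d\<close>, already \<open>x d = 0\<close>. For \<open>e\<close> the multiple is \<open>\<gamma>\<close>; if \<open>\<gamma>\<close> were zero, \<open>e d\<close> could survive.
\<close>

lemma mul_d_0:
  assumes "g \<noteq> Ga"
  shows "G g \<star> d = 0" "d \<star> G g = 0"
proof -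
  have neg: "- x - x = 0 \<Longrightarrow> x = 0" for x :: 'v
    using double_eq_0[of "- x"] by (metis diff_conv_add_uminus neg_equal_0_iff_equal)
  have "b \<star> d + b \<star> d = 0"
    using commutator_jordan_associator[of a b c]
    unfolding commutators ass_a_b_c by (simp add: commuting)
  then have b: "b \<star> d = 0" by (rule double_eq_0)
  have "- (c \<star> d) - c \<star> d = 0"
    using commutator_jordan_associator[of a c b]
    unfolding commutators ass_swap23[of a c b] ass_a_b_c by (simp add: commuting)
  then have c: "c \<star> d = 0" by (rule neg)
  have "- (d \<star> d) - d \<star> d = 0"
    using commutator_jordan_associator_linearized[of a d b c]
    unfolding commutators ass_a_b_c ass_a_x_c_0 by simp
  then have d: "d \<star> d = 0" by (rule neg)
  have "- scale \<gamma> (d \<star> e) - scale \<gamma> (d \<star> e) = 0"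
    using commutator_jordan_associator_linearized[of a e b c]
    unfolding commutators ass_a_b_c ass_a_x_c_0 by (simp add: commuting scale_mul mul_scale)
  then have "scale \<gamma> (d \<star> e) = 0" by (rule neg)
  then have e: "d \<star> e = 0" using gamma_nz by simp
  show "G g \<star> d = 0" "d \<star> G g = 0"
    using assms b c d e by (cases g; simp add: commuting)+
qed

text \<open>
The left alternative law turns \<open>x (a u)\<close> into \<open>(x a + a x) u\<close>, and \<open>(a x) u\<close> equals \<open>-x (u a)\<close> by the formula for
multiplication by a product; \<open>(x a) u\<close> has the same value because \<open>[a, x]\<close> annihilates \<open>u\<close>. The second
equation is the mirror image.
\<close>

lemma annihilator_a_shift:
  assumes com: "a \<star> x - x \<star> a = scale r x" and 0: "x \<star> u = 0" "u \<star> x = 0"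
  shows "x \<star> (a \<star> u) = - (x \<star> (u \<star> a) + x \<star> (u \<star> a))"
    and "(u \<star> a) \<star> x = - ((a \<star> u) \<star> x + (a \<star> u) \<star> x)"
proof -
  have ax: "a \<star> x = x \<star> a + scale r x" using com by (simp add: algebra_simps)
  have "(a \<star> x) \<star> u = - (x \<star> (u \<star> a))"
    using mul_left_product[of a x u] by (simp add: 0)
  moreover have "(x \<star> a) \<star> u = (a \<star> x) \<star> u" by (simp add: ax mul_distribs scale_mul 0)
  moreover have "(x \<star> a) \<star> u + (a \<star> x) \<star> u = x \<star> (a \<star> u)"
    using ass_swap12[of x a u] by (simp add: ass_def 0 algebra_simps)
  ultimately show "x \<star> (a \<star> u) = - (x \<star> (u \<star> a) + x \<star> (u \<star> a))" by simp
  have "u \<star> (x \<star> a) = - ((a \<star> u) \<star> x)"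
    using mul_right_product[of u x a] by (simp add: 0)
  moreover have "u \<star> (a \<star> x) = u \<star> (x \<star> a)" by (simp add: ax mul_distribs mul_scale 0)
  moreover have "(u \<star> a) \<star> x = u \<star> (x \<star> a) + u \<star> (a \<star> x)"
    using ass_swap23[of u a x] by (simp add: ass_def 0 algebra_simps)
  ultimately show "(u \<star> a) \<star> x = - ((a \<star> u) \<star> x + (a \<star> u) \<star> x)" by simp
qed

definition apow_d :: "nat \<Rightarrow> 'v" where "apow_d i = (mul a ^^ i) d"

text \<open>
By the flexible law a factor \<open>a\<close> on the right can be moved inwards to \<open>d\<close>, where \<open>d a = (a - 1) d\<close>.
\<close>

lemma apow_d_simps: "apow_d 0 = d" "apow_d (Suc i) = a \<star> apow_d i" "apow_d i \<star> a = apow_d (Suc i) - apow_d i"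
proof -
  show *: "apow_d 0 = d" "apow_d (Suc i) = a \<star> apow_d i" for i by (simp_all add: apow_d_def)
  show "apow_d i \<star> a = apow_d (Suc i) - apow_d i"
    by (induction i) (simp_all add: * a_left flexible mul_distribs)
qed

lemma eigenvector: 
  assumes "g \<noteq> Ga" obtains r where "a \<star> G g - G g \<star> a = scale r (G g)"
proof (cases g)
  case Gb show ?thesis by (rule that[of "- 1"]) (simp add: Gb commutators)
next
  case Gc show ?thesis by (rule that[of "- 1"]) (simp add: Gc commutators)
next
  case Gd show ?thesis by (rule that[of 1]) (simp add: Gd commutators)
next
  case Ge show ?thesis by (rule that[of \<gamma>]) (simp add: Ge commutators)
qed (use assms in simp)

text \<open>
If \<open>x\<close> annihilates \<open>a\<^sup>i d\<close>, the previous lemmas give \<open>x (a\<^sup>i\<^sup>+\<^sup>1 d) = -2 x (a\<^sup>i\<^sup>+\<^sup>1 d)\<close>, so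
three times this product vanishes.
\<close>

lemma mul_apow_d_0:
  assumes g: "g \<noteq> Ga"
  shows "G g \<star> apow_d i = 0" and "apow_d i \<star> G g = 0"
proof -
  obtain r where r: "a \<star> G g - G g \<star> a = scale r (G g)" using eigenvector[OF g] .
  have "G g \<star> apow_d i = 0 \<and> apow_d i \<star> G g = 0"
  proof (induction i)
    case 0 then show ?case using g by (simp add: apow_d_simps mul_d_0)
  next
    case (Suc i)
    then have 0: "G g \<star> apow_d i = 0" "apow_d i \<star> G g = 0" by auto
    have "G g \<star> (apow_d i \<star> a) = G g \<star> apow_d (Suc i)" "(apow_d i \<star> a) \<star> G g = apow_d (Suc i) \<star> G g"
      by (simp_all only: apow_d_simps(3) mul_diff 0 diff_zero)
    then have "G g \<star> apow_d (Suc i) = - (G g \<star> apow_d (Suc i) + G g \<star> apow_d (Suc i))"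
      and "apow_d (Suc i) \<star> G g = - (apow_d (Suc i) \<star> G g + apow_d (Suc i) \<star> G g)"
      using annihilator_a_shift[OF r 0] by (simp_all only: apow_d_simps(2)[symmetric])
    then show ?case
      by (metis add.commute add.right_inverse triple_eq_0)
  qed
  then show "G g \<star> apow_d i = 0" "apow_d i \<star> G g = 0" by auto
qed

definition d_span :: "'v set" where "d_span = span (range apow_d)"

lemma subspace_D: "subspace d_span" by (simp add: d_span_def)

lemma span_image_subset:
  assumes T: "subspace W" and x: "x \<in> span B" and B: "\<And>y. y \<in> B \<Longrightarrow> f y \<in> W"
    and add: "\<And>y z. f (y + z) = f y + f z" and sc: "\<And>r y. f (scale r y) = scale r (f y)"
  shows "f x \<in> W"
proof -
  have 0: "f 0 = 0" using sc[of 0 0] by simp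
  have "subspace {x. f x \<in> W}"
    by (rule subspaceI) (simp_all add: 0 add sc subspace_0[OF T] subspace_add[OF T] subspace_scale[OF T])
  then have "span B \<subseteq> {x. f x \<in> W}"
    using B by (intro span_minimal) auto
  then show ?thesis using x by auto
qed

lemma mul_mem_span:
  assumes "subspace W" "x \<in> span B" "\<And>y. y \<in> B \<Longrightarrow> u \<star> y \<in> W"
  shows "u \<star> x \<in> W"
  using span_image_subset[OF assms(1,2), of "mul u"] assms(3) by (auto simp: mul_add mul_scale)

lemma mem_span_mul:
  assumes "subspace W" "x \<in> span B" "\<And>y. y \<in> B \<Longrightarrow> y \<star> u \<in> W"
  shows "x \<star> u \<in> W"
  using span_image_subset[OF assms(1,2), of "\<lambda>x. x \<star> u"] assms(3) by (auto simp: add_mul scale_mul)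

lemma apow_d_in_D: "apow_d i \<in> d_span" by (simp add: d_span_def span_base)

lemma mul_mem_D: "x \<in> d_span \<Longrightarrow> (\<And>i. u \<star> apow_d i \<in> d_span) \<Longrightarrow> u \<star> x \<in> d_span"
  using mul_mem_span[OF subspace_D, of x "range apow_d" u] unfolding d_span_def by blast

lemma D_mul_mem: "x \<in> d_span \<Longrightarrow> (\<And>i. apow_d i \<star> u \<in> d_span) \<Longrightarrow> x \<star> u \<in> d_span"
  using mem_span_mul[OF subspace_D, of x "range apow_d" u] unfolding d_span_def by blast

lemma gen_mul_D: "x \<in> d_span \<Longrightarrow> G g \<star> x \<in> d_span" and D_mul_gen: "x \<in> d_span \<Longrightarrow> x \<star> G g \<in> d_span"
proof -
  have "G g \<star> apow_d i \<in> d_span \<and> apow_d i \<star> G g \<in> d_span" for i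
    using apow_d_in_D[of "Suc i"] apow_d_in_D[of i] subspace_0[OF subspace_D] subspace_diff[OF subspace_D]
    by (cases "g = Ga") (auto simp: mul_apow_d_0 apow_d_simps)
  then show "x \<in> d_span \<Longrightarrow> G g \<star> x \<in> d_span" "x \<in> d_span \<Longrightarrow> x \<star> G g \<in> d_span"
    using mul_mem_D[of x "G g"] D_mul_mem[of x "G g"] by auto
qed

text \<open>
The Jacobian of any three generators is a multiple of \<open>d\<close>.
\<close>

lemma ass_gen_in_D: "ass (G g) (G h) (G k) \<in> d_span"
proof -
  have d: "scale r d \<in> d_span" for r using apow_d_in_D[of 0] subspace_scale[OF subspace_D] by (simp add: apow_d_simps)
  have "scale 6 (ass (G g) (G h) (G k)) \<in> d_span"
    unfolding jacobian_eq_associator[OF refl, symmetric]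
    by (cases g; cases h; cases k)
      (simp_all add: a_left commuting mul_distribs scale_mul mul_scale scale_right_diff_distrib
        subspace_0 subspace_add subspace_diff subspace_neg subspace_D d)
  then have "scale (1/6) (scale 6 (ass (G g) (G h) (G k))) \<in> d_span"
    by (rule subspace_scale[OF subspace_D])
  then show ?thesis by simp
qed

text \<open>
The elements that associate with two generators up to elements of \<open>d_span\<close>. That they also map \<open>d_span\<close> to itself is
part of the definition because the inductive step \<open>gen_mul_tame\<close> multiplies associators by them.
\<close>

definition tame :: "'v set" where
  "tame = {u. (\<forall>x\<in>d_span. u \<star> x \<in> d_span \<and> x \<star> u \<in> d_span) \<and> (\<forall>g h. ass (G g) (G h) u \<in> d_span)}"

lemma one_in_tame: "one \<in> tame"
proof -
  have "one \<star> apow_d i \<in> d_span \<and> apow_d i \<star> one \<in> d_span" for i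
    using apow_d_in_D[of i] by (cases i) (simp_all add: apow_d_simps(1,2) one_gen one_product)
  then have "x \<in> d_span \<Longrightarrow> one \<star> x \<in> d_span" "x \<in> d_span \<Longrightarrow> x \<star> one \<in> d_span" for x
    using mul_mem_D[of x one] D_mul_mem[of x one] by auto
  moreover have "ass (G g) (G h) one = 0" for g h
    by (simp add: ass_def one_gen one_product)
  ultimately show ?thesis
    using subspace_0[OF subspace_D] by (auto simp: tame_def)
qed

lemma ass_sum1: "finite I \<Longrightarrow> ass (sum f I) y z = (\<Sum>i\<in>I. ass (f i) y z)"
  by (induction I rule: finite_induct) (simp_all add: ass_add, simp add: ass_def)

text \<open>
The associator of \<open>k u\<close> with generators \<open>g\<close>, \<open>h\<close> is the Kleinfeld function of \<open>k, u, g, h\<close> up to terms that lie in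
\<open>d_span\<close>. By skew symmetry that is also its value at \<open>g, h, k, u\<close>, which \<open>kleinfeld_commutator\<close> expresses through
associators of \<open>u\<close> with two generators, since \<open>[g, h]\<close> is a combination of generators.
\<close>

lemma gen_mul_tame:
  assumes u: "u \<in> tame" shows "G k \<star> u \<in> tame"
proof -
  note sD = subspace_D
  have uD: "x \<in> d_span \<Longrightarrow> u \<star> x \<in> d_span" "x \<in> d_span \<Longrightarrow> x \<star> u \<in> d_span" and ass: "ass (G g) (G h) u \<in> d_span" for x g h
    using u by (auto simp: tame_def)
  have 1: "(G k \<star> u) \<star> x \<in> d_span \<and> x \<star> (G k \<star> u) \<in> d_span" if "x \<in> d_span" for x
    unfolding mul_left_product[of "G k" u] mul_right_product[of x "G k" u]
    using that by (intro conjI subspace_add[OF sD] subspace_diff[OF sD] uD gen_mul_D D_mul_gen)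
  have "ass (G g) (G h) (G k \<star> u) \<in> d_span" for g h
  proof -
    have "ass (G g \<star> G h - G h \<star> G g) (G k) u \<in> d_span"
      unfolding commutator ass_sum1[OF finite] ass_scale
      by (intro subspace_sum[OF sD] subspace_scale[OF sD] ass)
    then have "kleinfeld (G g) (G h) (G k) u + kleinfeld (G g) (G h) (G k) u \<in> d_span"
      unfolding kleinfeld_commutator
      by (intro subspace_add[OF sD] subspace_diff[OF sD] uD gen_mul_D D_mul_gen ass)
    then have "scale (1/2) (scale 2 (kleinfeld (G g) (G h) (G k) u)) \<in> d_span"
      unfolding scale_two by (rule subspace_scale[OF sD])
    then have "kleinfeld (G g) (G h) (G k) u \<in> d_span" by simp
    then have "kleinfeld (G k) u (G g) (G h) \<in> d_span"
      using kleinfeld_swap_pairs[of "G k" u "G g" "G h"] by simp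
    moreover have "ass (G k \<star> u) (G g) (G h) =
        kleinfeld (G k) u (G g) (G h) + u \<star> ass (G k) (G g) (G h) + ass u (G g) (G h) \<star> G k"
      by (simp add: kleinfeld_def)
    moreover have "u \<star> ass (G k) (G g) (G h) \<in> d_span"
    using uD(1) ass_gen_in_D by blast
    moreover have "ass u (G g) (G h) \<star> G k \<in> d_span"
      using ass[of g h] ass_rotate[of "G g" "G h" u] by (simp add: D_mul_gen)
    ultimately have "ass (G k \<star> u) (G g) (G h) \<in> d_span" by (simp add: subspace_add[OF sD])
    then show ?thesis using ass_rotate[of "G g" "G h" "G k \<star> u"] by simp
  qed
  with 1 show ?thesis by (auto simp: tame_def)
qed
end

fun word_value :: "('v \<Rightarrow> 'v \<Rightarrow> 'v) \<Rightarrow> ('g \<Rightarrow> 'v) \<Rightarrow> 'g nword \<Rightarrow> 'v" where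
  "word_value mul val (Letter g) = val g"
| "word_value mul val (Times u v) = mul (word_value mul val u) (word_value mul val v)"

definition (in malcev_generators) abce :: "nat \<Rightarrow> nat \<Rightarrow> nat \<Rightarrow> nat \<Rightarrow> 'v" where
  "abce i j k m = (mul a ^^ i) ((mul b ^^ j) ((mul c ^^ k) ((mul e ^^ m) one)))"

fun (in malcev_generators) basis_vector :: "nat + nat \<times> nat \<times> nat \<times> nat \<Rightarrow> 'v" where
  "basis_vector (Inl i) = apow_d i"
| "basis_vector (Inr (i, j, k, m)) = abce i j k m"

abbreviation (in malcev_generators) word_val :: "gen nword \<Rightarrow> 'v" where
  "word_val \<equiv> word_value mul G"

context malcev_generators
begin

lemma funpow_tame: "u \<in> tame \<Longrightarrow> (mul (G g) ^^ n) u \<in> tame"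
  by (induction n) (auto intro: gen_mul_tame)

text \<open>
Modulo \<open>d_span\<close>, left multiplications by generators commute up to left multiplication by the commutator. This is
what makes the straightening of Poincare, Birkhoff and Witt available.
\<close>

lemma gen_commute_mod_D:
  assumes "u \<in> tame"
  shows "G g \<star> (G h \<star> u) - G h \<star> (G g \<star> u) - (G g \<star> G h - G h \<star> G g) \<star> u \<in> d_span"
proof -
  have "ass (G h) (G g) u - ass (G g) (G h) u \<in> d_span"
    using assms by (intro subspace_diff[OF subspace_D]) (auto simp: tame_def)
  then show ?thesis by (simp add: ass_def mul_distribs algebra_simps)
qed

lemma gen_swap_D:
  assumes u: "u \<in> tame" and com: "(G g \<star> G h - G h \<star> G g) \<star> u \<in> d_span" and v: "G g \<star> u - v \<in> d_span"
  shows "G g \<star> (G h \<star> u) - G h \<star> v \<in> d_span"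
proof -
  have "G g \<star> (G h \<star> u) - G h \<star> v =
      (G g \<star> (G h \<star> u) - G h \<star> (G g \<star> u) - (G g \<star> G h - G h \<star> G g) \<star> u)
      + (G g \<star> G h - G h \<star> G g) \<star> u + G h \<star> (G g \<star> u - v)"
    by (simp add: mul_diff)
  also have "\<dots> \<in> d_span"
    by (intro subspace_add[OF subspace_D] gen_commute_mod_D u com gen_mul_D v)
  finally show ?thesis .
qed

lemma gen_swap_funpow_D:
  assumes u: "u \<in> tame" and com: "\<And>n. (G g \<star> G h - G h \<star> G g) \<star> ((mul (G h) ^^ n) u) \<in> d_span"
    and v: "G g \<star> u - v \<in> d_span"
  shows "G g \<star> ((mul (G h) ^^ n) u) - (mul (G h) ^^ n) v \<in> d_span"
  by (induction n) (auto simp: v intro!: gen_swap_D funpow_tame u com)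

lemma zero_in_D: "0 \<in> d_span" by (rule subspace_0[OF subspace_D])

text \<open>
Left multiplication by \<open>d\<close> can be moved to the right through generators, so it takes every monomial to
\<open>d_span\<close>; consequently \<open>b\<close> and \<open>c\<close> commute modulo \<open>d_span\<close> on monomials, although \<open>[b, c] = 2d\<close>.
\<close>

lemma d_mul_gen_D:
  assumes u: "u \<in> tame" and d: "d \<star> u \<in> d_span"
  shows "d \<star> (G g \<star> u) \<in> d_span"
proof -
  have "\<exists>r. d \<star> G g - G g \<star> d = scale r d"
    by (cases g) (auto simp: a_left commuting intro: exI[of _ "- 1"] exI[of _ "0"])
  then obtain r where "d \<star> G g - G g \<star> d = scale r d" ..
  then have "(d \<star> G g - G g \<star> d) \<star> u \<in> d_span"
    by (simp add: scale_mul subspace_scale[OF subspace_D] d)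
  then show ?thesis
    using gen_swap_D[OF u, of Gd g 0] d by simp
qed

lemma d_mul_funpow_D: "u \<in> tame \<Longrightarrow> d \<star> u \<in> d_span \<Longrightarrow> d \<star> ((mul (G g) ^^ n) u) \<in> d_span"
  by (induction n) (auto intro: d_mul_gen_D funpow_tame)

definition monomial_span :: "'v set" where
  "monomial_span = span (range basis_vector)"

lemma abce_Suc: "abce (Suc i) j k m = a \<star> abce i j k m"
  by (simp add: abce_def)

lemma abce_tame: "abce i j k m \<in> tame"
  by (simp add: abce_def funpow_tame one_in_tame)

lemma subspace_S: "subspace monomial_span" by (simp add: monomial_span_def)

lemma D_subset_S: "x \<in> d_span \<Longrightarrow> x \<in> monomial_span"
  unfolding d_span_def monomial_span_def
  using span_mono[of "range apow_d" "range basis_vector"] by (metis basis_vector.simps(1) image_subset_iff rangeI subsetD)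

lemma abce_in_S: "abce i j k m \<in> monomial_span"
  unfolding monomial_span_def by (metis basis_vector.simps(2) rangeI span_base)

lemma basis_vector_cases:
  "(\<And>i. P (apow_d i)) \<Longrightarrow> (\<And>i j k m. P (abce i j k m)) \<Longrightarrow> y \<in> range basis_vector \<Longrightarrow> P y"
  by (metis basis_vector.simps imageE sumE surj_pair)

lemma mul_mem_S:
  "x \<in> monomial_span \<Longrightarrow> (\<And>i. u \<star> apow_d i \<in> monomial_span) \<Longrightarrow> (\<And>i j k m. u \<star> abce i j k m \<in> monomial_span) \<Longrightarrow> u \<star> x \<in> monomial_span"
  using mul_mem_span[OF subspace_S, of x "range basis_vector" u]
    basis_vector_cases[of "\<lambda>y. u \<star> y \<in> monomial_span"] unfolding monomial_span_def by blast

lemma S_mul_mem: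
  "x \<in> monomial_span \<Longrightarrow> (\<And>i. apow_d i \<star> u \<in> monomial_span) \<Longrightarrow> (\<And>i j k m. abce i j k m \<star> u \<in> monomial_span) \<Longrightarrow> x \<star> u \<in> monomial_span"
  using mem_span_mul[OF subspace_S, of x "range basis_vector" u]
    basis_vector_cases[of "\<lambda>y. y \<star> u \<in> monomial_span"] unfolding monomial_span_def by blast

lemma a_mul_S: "x \<in> monomial_span \<Longrightarrow> a \<star> x \<in> monomial_span"
  by (rule mul_mem_S)
    (auto simp: abce_Suc[symmetric] apow_d_simps(2)[symmetric] intro: abce_in_S D_subset_S apow_d_in_D)

lemma mod_D_in_S: "x - y \<in> d_span \<Longrightarrow> y \<in> monomial_span \<Longrightarrow> x \<in> monomial_span"
  using subspace_add[OF subspace_S, of "x - y" y] D_subset_S by simp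

text \<open>
Straightening of a monomial without factors \<open>a\<close>: the new factor is moved to its place, at the cost of
terms in \<open>d_span\<close>; if it is \<open>d\<close>, only such terms remain.
\<close>

lemma gen_mul_abce_0:
  assumes "g \<noteq> Ga" shows "G g \<star> abce 0 j k m \<in> monomial_span"
proof (cases g)
  case Gb
  have "G g \<star> abce 0 j k m = abce 0 (Suc j) k m" by (simp add: Gb abce_def)
  then show ?thesis by (simp add: abce_in_S)
next
  case Gc
  have "d \<star> one = d" by (simp add: one_gen)
  then have d1: "d \<star> ((mul b ^^ n) ((mul c ^^ k) ((mul e ^^ m) one))) \<in> d_span" for n
    using apow_d_in_D[of 0] by (auto simp: apow_d_simps(1) intro!: d_mul_funpow_D funpow_tame one_in_tame)
  have "c \<star> abce 0 j k m - abce 0 j (Suc k) m \<in> d_span"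
    unfolding abce_def
    by (simp, rule gen_swap_funpow_D)
      (auto simp: a_left scale_mul zero_in_D intro!: funpow_tame one_in_tame subspace_scale[OF subspace_D] subspace_neg[OF subspace_D] d1)
  then show ?thesis using mod_D_in_S abce_in_S Gc by blast
next
  case Gd
  have "d \<star> one = d" by (simp add: one_gen)
  then have "d \<star> abce 0 j k m \<in> d_span"
    using apow_d_in_D[of 0] by (auto simp: abce_def apow_d_simps(1) intro!: d_mul_funpow_D funpow_tame one_in_tame)
  then show ?thesis using D_subset_S Gd by simp
next
  case Ge
  have "e \<star> abce 0 j k m - abce 0 j k (Suc m) \<in> d_span"
    unfolding abce_def
    by (simp, rule gen_swap_funpow_D[OF _ _ gen_swap_funpow_D])
      (auto simp: commuting zero_in_D intro!: funpow_tame one_in_tame)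
  then show ?thesis using mod_D_in_S abce_in_S Ge by blast
qed (use assms in simp)

lemma gen_mul_abce: "G g \<star> abce i j k m \<in> monomial_span"
proof (cases "g = Ga")
  case True then show ?thesis by (simp add: a_mul_S abce_in_S)
next
  case False
  obtain r where r: "a \<star> G g - G g \<star> a = scale r (G g)" using eigenvector[OF False] .
  then have r': "G g \<star> a - a \<star> G g = - scale r (G g)" by (simp add: algebra_simps)
  show ?thesis
  proof (induction i)
    case 0 show ?case by (rule gen_mul_abce_0[OF False])
  next
    case (Suc i)
    let ?u = "abce i j k m"
    have "G g \<star> (a \<star> ?u) - (a \<star> (G g \<star> ?u) - scale r (G g \<star> ?u)) \<in> d_span"
      using gen_commute_mod_D[OF abce_tame, of g Ga i j k m] unfolding r'
      by (simp add: scale_mul algebra_simps)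
    then show ?case
      unfolding abce_Suc
      by (rule mod_D_in_S)
        (intro subspace_diff[OF subspace_S] subspace_scale[OF subspace_S] a_mul_S Suc.IH)
  qed
qed

lemma gen_mul_S: "x \<in> monomial_span \<Longrightarrow> G g \<star> x \<in> monomial_span"
  by (rule mul_mem_S) (auto intro: gen_mul_abce D_subset_S gen_mul_D apow_d_in_D)

lemma one_in_S: "one \<in> monomial_span"
  using abce_in_S[of 0 0 0 0] by (simp add: abce_def)

text \<open>
Right multiplication reduces to left multiplication, because \<open>(h u) g\<close> and \<open>h (u g)\<close> agree modulo \<open>d_span\<close>.
\<close>

lemma tame_mul_gen_S:
  assumes u: "u \<in> tame" and "u \<star> G g \<in> monomial_span"
  shows "(G h \<star> u) \<star> G g \<in> monomial_span"
proof -
  have "ass (G h) (G g) u \<in> d_span" using u by (simp add: tame_def)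
  then have "ass (G h) u (G g) \<in> d_span"
    by (simp add: ass_swap23[of "G h" u "G g"] subspace_neg[OF subspace_D])
  then show ?thesis
    unfolding ass_def by (rule mod_D_in_S) (intro gen_mul_S assms)
qed

lemma funpow_mul_gen_S:
  "u \<in> tame \<Longrightarrow> u \<star> G g \<in> monomial_span \<Longrightarrow> ((mul (G h) ^^ n) u) \<star> G g \<in> monomial_span"
  by (induction n) (auto intro: tame_mul_gen_S funpow_tame)

lemma S_mul_gen: "x \<in> monomial_span \<Longrightarrow> x \<star> G g \<in> monomial_span"
proof (rule S_mul_mem)
  have "one \<star> G g \<in> monomial_span"
    using gen_mul_S[OF one_in_S, of g] by (simp add: one_gen)
  then show "abce i j k m \<star> G g \<in> monomial_span" for i j k m
    unfolding abce_def by (intro funpow_mul_gen_S funpow_tame one_in_tame)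
qed (auto intro: D_subset_S D_mul_gen apow_d_in_D)

lemma word_value_mul_S: "x \<in> monomial_span \<Longrightarrow> word_val w \<star> x \<in> monomial_span \<and> x \<star> word_val w \<in> monomial_span"
proof (induction w arbitrary: x)
  case (Letter g) then show ?case by (simp add: gen_mul_S S_mul_gen)
next
  case (Times u v)
  then show ?case
    using mul_left_product[of "word_val u" "word_val v" x] mul_right_product[of x "word_val u" "word_val v"]
    by (simp add: subspace_add[OF subspace_S] subspace_diff[OF subspace_S])
qed

lemma word_value_in_S: "word_val w \<in> monomial_span"
proof -
  have "word_val w \<star> one = word_val w" by (cases w) (simp_all add: one_gen one_product)
  then show ?thesis using word_value_mul_S[OF one_in_S, of w] by simp
qed

end


section \<open>Evaluation of words in an alternative algebra\<close>

fun word_option_value :: "('v \<Rightarrow> 'v \<Rightarrow> 'v) \<Rightarrow> 'v \<Rightarrow> ('g \<Rightarrow> 'v) \<Rightarrow> 'g nword option \<Rightarrow> 'v" where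
  "word_option_value mul u val None = u"
| "word_option_value mul u val (Some w) = word_value mul val w"

text \<open>
Products are required to be linear on the right for values of words only. In this way the composition of
arbitrary functions on a vector space is admitted as a product, provided the generators act
linearly.
\<close>

locale alternative_representation = vector_space scale
  for scale :: "'k::field \<Rightarrow> 'v::ab_group_add \<Rightarrow> 'v" +
  fixes mul :: "'v \<Rightarrow> 'v \<Rightarrow> 'v"  (infixl "\<star>" 70) and one :: 'v and val :: "'g \<Rightarrow> 'v"
    and B :: "'g \<Rightarrow> 'g \<Rightarrow> ('g \<Rightarrow>\<^sub>0 'k)"
  assumes add_mul: "(x + y) \<star> z = x \<star> z + y \<star> z"
    and scale_mul: "scale r x \<star> y = scale r (x \<star> y)"
    and word_mul_add: "word_value mul val w \<star> (y + z) = word_value mul val w \<star> y + word_value mul val w \<star> z"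
    and word_mul_scale: "word_value mul val w \<star> scale r y = scale r (word_value mul val w \<star> y)"
    and one_mul: "one \<star> x = x" "x \<star> one = x"
    and left_alternative: "(x \<star> x) \<star> y = x \<star> (x \<star> y)"
    and right_alternative: "(y \<star> x) \<star> x = y \<star> (x \<star> x)"
    and commutator: "val g \<star> val h - val h \<star> val g = linear_extension scale val (B g h)"
begin

abbreviation "wval \<equiv> word_option_value mul one val"

definition eval :: "('g, 'k) free \<Rightarrow> 'v" where
  "eval = linear_extension scale wval"

lemma eval_linear: "eval 0 = 0" "eval (x + y) = eval x + eval y" "eval (pm_scale r x) = scale r (eval x)"
    "eval (x - y) = eval x - eval y" "eval (- x) = - eval x"
    "eval (sum f I) = (\<Sum>i\<in>I. eval (f i))"
  by (simp_all add: eval_def linear_extension_add linear_extension_scale linear_extension_diff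
      linear_extension_minus linear_extension_sum)

lemma eval_word [simp]: "eval (word w) = wval w"
  by (simp add: eval_def)

lemma wval_mult: "wval (word_mult u v) = wval u \<star> wval v"
  by (cases u; cases v) (simp_all add: one_mul)

lemma wval_mul_add: "wval w \<star> (y + z) = wval w \<star> y + wval w \<star> z"
  by (cases w) (simp_all add: one_mul word_mul_add)

lemma wval_mul_scale: "wval w \<star> scale r y = scale r (wval w \<star> y)"
  by (cases w) (simp_all add: one_mul word_mul_scale)

lemma wval_mul_zero: "wval w \<star> 0 = 0"
  using wval_mul_scale[of w 0 0] by simp

lemma zero_mul: "0 \<star> y = 0"
  using scale_mul[of 0 0 y] by simp

lemma eval_mul: "eval x \<star> z = linear_extension scale (\<lambda>w. wval w \<star> z) x"
  unfolding eval_def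
  by (rule linear_extension_compose) (simp_all add: add_mul scale_mul zero_mul)

lemma eval_mul_zero: "eval x \<star> 0 = 0"
  by (simp add: eval_mul wval_mul_zero linear_extension_def)

lemma eval_mult: "eval (x \<cdot> y) = eval x \<star> eval y"
proof -
  have 1: "eval (linear_extension pm_scale f z) = linear_extension scale (\<lambda>i. eval (f i)) z"
    for f :: "'g nword option \<Rightarrow> ('g, 'k) free" and z
    by (rule linear_extension_compose) (simp_all add: eval_linear)
  have 2: "wval w \<star> linear_extension scale f z = linear_extension scale (\<lambda>i. wval w \<star> f i) z"
    for f :: "'g nword option \<Rightarrow> 'v" and w z
    by (rule linear_extension_compose) (simp_all add: wval_mul_add wval_mul_scale wval_mul_zero)
  show ?thesis
    unfolding free_mult_def bilinear_extension_eq 1 eval_mul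
    by (simp add: wval_mult eval_def[of] 2)
qed

lemma eval_kernel_ideal: "alg_ideal free_algebra {x. eval x = 0}"
  unfolding free_ideal_iff by (simp add: eval_linear eval_mult zero_mul eval_mul_zero)

lemma eval_alternator:
  "eval ((x \<cdot> x) \<cdot> y - x \<cdot> (x \<cdot> y)) = 0" "eval ((y \<cdot> x) \<cdot> x - y \<cdot> (x \<cdot> x)) = 0"
  by (simp_all add: eval_linear eval_mult left_alternative right_alternative)

text \<open>
The commutator relation for arbitrary elements of the Malcev algebra is a linear combination of the
relations for pairs of basis vectors, so only the latter have to be verified in a model.
\<close>

lemma embed_mult_commutator:
  "embed s \<cdot> embed t - embed t \<cdot> embed s - embed (bilinear_extension B s t) =
    bilinear_extension (\<lambda>g h. letter g \<cdot> letter h - letter h \<cdot> letter g - embed (B g h)) s t"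
proof -
  have l: "linear_extension pm_scale f z \<cdot> u = linear_extension pm_scale (\<lambda>i. f i \<cdot> u) z"
    for f :: "'g \<Rightarrow> ('g, 'k) free" and z u
    by (rule linear_extension_compose[where F = "\<lambda>x. x \<cdot> u"]) (simp_all add: free_mult_add free_mult_scale)
  have r: "u \<cdot> linear_extension pm_scale f z = linear_extension pm_scale (\<lambda>i. u \<cdot> f i) z"
    for f :: "'g \<Rightarrow> ('g, 'k) free" and z u
    by (rule linear_extension_compose[where F = "\<lambda>x. u \<cdot> x"]) (simp_all add: free_mult_add free_mult_scale)
  have e: "embed (linear_extension pm_scale f z) = linear_extension pm_scale (\<lambda>i. embed (f i)) z"
    for f :: "'g \<Rightarrow> ('g \<Rightarrow>\<^sub>0 'k)" and z
    by (rule linear_extension_compose) (simp_all add: embed_eq pm.linear_extension_add pm.linear_extension_scale)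
  have 1: "embed s \<cdot> embed t = bilinear_extension (\<lambda>g h. letter g \<cdot> letter h) s t"
    by (simp add: embed_eq l r bilinear_extension_eq')
  have 2: "embed t \<cdot> embed s = bilinear_extension (\<lambda>g h. letter h \<cdot> letter g) s t"
    by (simp add: embed_eq l r bilinear_extension_eq)
  have 3: "embed (bilinear_extension B s t) = bilinear_extension (\<lambda>g h. embed (B g h)) s t"
    by (simp add: e bilinear_extension_eq)
  show ?thesis
    unfolding 1 2 3 unfolding bilinear_extension_def
    by (simp add: sum_subtractf pm.scale_right_diff_distrib)
qed

lemma eval_embed: "eval (embed s) = linear_extension scale val s"
  unfolding embed_eq
  by (subst linear_extension_compose[where F = eval]) (simp_all add: eval_linear)

lemma eval_relation:
  "eval (embed s \<cdot> embed t - embed t \<cdot> embed s - embed (bilinear_extension B s t)) = 0"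
  unfolding embed_mult_commutator
  by (simp add: bilinear_extension_def eval_linear eval_mult eval_embed commutator)

text \<open>
Two of the three families of relations are linearized alternators: the alternator is quadratic in its
repeated argument, and its polarization vanishes together with it.
\<close>

lemma eval_envelope_relations:
  assumes "z \<in> envelope_relations (bilinear_extension B)" shows "eval z = 0"
proof -
  have 0: "eval u = 0 \<Longrightarrow> eval v = 0 \<Longrightarrow> eval w = 0 \<Longrightarrow> eval (u - v - w) = 0" for u v w
    by (simp add: eval_linear)
  have 1: "eval (((s \<cdot> x) \<cdot> y - s \<cdot> (x \<cdot> y)) + ((x \<cdot> s) \<cdot> y - x \<cdot> (s \<cdot> y))) = 0" for s x y
  proof -
    have "((s \<cdot> x) \<cdot> y - s \<cdot> (x \<cdot> y)) + ((x \<cdot> s) \<cdot> y - x \<cdot> (s \<cdot> y)) =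
        (((s + x) \<cdot> (s + x)) \<cdot> y - (s + x) \<cdot> ((s + x) \<cdot> y))
        - ((s \<cdot> s) \<cdot> y - s \<cdot> (s \<cdot> y)) - ((x \<cdot> x) \<cdot> y - x \<cdot> (x \<cdot> y))"
      by (simp add: free_mult_add algebra_simps)
    then show ?thesis by (simp only:) (intro 0 eval_alternator)
  qed
  have 2: "eval (((x \<cdot> s) \<cdot> y - x \<cdot> (s \<cdot> y)) + ((x \<cdot> y) \<cdot> s - x \<cdot> (y \<cdot> s))) = 0" for s x y
  proof -
    have "((x \<cdot> s) \<cdot> y - x \<cdot> (s \<cdot> y)) + ((x \<cdot> y) \<cdot> s - x \<cdot> (y \<cdot> s)) =
        ((x \<cdot> (s + y)) \<cdot> (s + y) - x \<cdot> ((s + y) \<cdot> (s + y)))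
        - ((x \<cdot> s) \<cdot> s - x \<cdot> (s \<cdot> s)) - ((x \<cdot> y) \<cdot> y - x \<cdot> (y \<cdot> y))"
      by (simp add: free_mult_add algebra_simps)
    then show ?thesis by (simp only:) (intro 0 eval_alternator)
  qed
  from assms show ?thesis
    unfolding envelope_relations_def by (auto simp: free_associator eval_relation 1 2)
qed

lemma eval_proj_kernel: "x \<in> proj_kernel (bilinear_extension B) \<Longrightarrow> eval x = 0"
  using proj_kernel_minimal[OF eval_kernel_ideal, of "bilinear_extension B"]
    eval_envelope_relations eval_alternator by blast

end


section \<open>Two models of the envelope\<close>

text \<open>
The first model. Its elements are \<open>f\<^sub>1 + f\<^sub>b b + f\<^sub>c c + f\<^sub>b\<^sub>c bc + f\<^sub>d d\<close>,
whose coefficients are functions of \<open>a\<close>, with \<open>b\<^sup>2 = c\<^sup>2 = e = 0\<close>. Functions are moved to the left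
by \<open>b f(a) = f(a+1) b\<close>, the same for \<open>c\<close>, and \<open>d f(a) = f(a-1) d\<close>. The three bracketed terms of the
\<open>Sd\<close> component make the algebra nonassociative; they are the correction terms of the structure
constants.
\<close>

datatype slot = S1 | Sb | Sc | Sbc | Sd

type_synonym 'k skew = "slot \<Rightarrow> 'k \<Rightarrow> 'k"

fun skew_mult :: "'k::field skew \<Rightarrow> 'k skew \<Rightarrow> 'k skew" where
  "skew_mult f g S1 t = f S1 t * g S1 t"
| "skew_mult f g Sb t = f S1 t * g Sb t + f Sb t * g S1 (t + 1)"
| "skew_mult f g Sc t = f S1 t * g Sc t + f Sc t * g S1 (t + 1)"
| "skew_mult f g Sbc t = f S1 t * g Sbc t + f Sb t * g Sc (t + 1) + f Sc t * g Sb (t + 1)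
     + f Sbc t * g S1 (t + 2)"
| "skew_mult f g Sd t = f S1 t * g Sd t + f Sd t * g S1 (t - 1)
     + (f Sb (t - 1) * g Sc (t - 1) - f Sb t * g Sc (t + 1))
     - (f Sc (t - 1) * g Sb (t - 1) + f Sc t * g Sb (t + 1))
     + f Sbc t * (g S1 (t - 1) - g S1 (t + 2))"

lemma skew_mult_left_alternative: fixes f g :: "'a::field skew" shows "skew_mult (skew_mult f f) g = skew_mult f (skew_mult f g)" (is "?l = ?r")
proof (intro ext)
  fix s and t :: 'a
  have [simp]: "t + 1 + 1 = t + 2" "t+2-1 = t + 1" "t - 1 + 2 = t + 1" by (simp_all add: algebra_simps)
  show "?l s t = ?r s t"
    by (cases s) (simp_all add: algebra_simps)
qed
lemma skew_mult_right_alternative: fixes f g :: "'a::field skew" shows "skew_mult (skew_mult g f) f = skew_mult g (skew_mult f f)" (is "?l = ?r")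
proof (intro ext)
  fix s and t :: 'a
  have [simp]: "t + 1 + 1 = t + 2" "t+2-1 = t + 1" "t - 1 + 2 = t + 1" by (simp_all add: algebra_simps)
  show "?l s t = ?r s t"
    by (cases s) (simp_all add: algebra_simps)
qed

fun skew_generator :: "gen \<Rightarrow> 'k::field skew" where
  "skew_generator Ga S1 t = t"
| "skew_generator Gb Sb t = 1"
| "skew_generator Gc Sc t = 1"
| "skew_generator Gd Sd t = 1"
| "skew_generator _ _ t = 0"

definition skew_scale :: "'k::field \<Rightarrow> 'k skew \<Rightarrow> 'k skew" where
  "skew_scale r f = (\<lambda>s t. r * f s t)"

fun skew_one :: "'k::field skew" where
  "skew_one S1 t = 1"
| "skew_one _ t = 0"

lemma skew_eqI:
  assumes "\<And>t. f S1 t = g S1 t" "\<And>t. f Sb t = g Sb t" "\<And>t. f Sc t = g Sc t"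
    "\<And>t. f Sbc t = g Sbc t" "\<And>t. f Sd t = g Sd t"
  shows "f = (g :: 'k skew)"
proof (intro ext)
  fix s t show "f s t = g s t" using assms by (cases s) simp_all
qed

interpretation skew: alternative_representation skew_scale skew_mult skew_one
    "skew_generator :: gen \<Rightarrow> 'k::field skew" "gen_bracket \<gamma>" for \<gamma>
proof (unfold_locales)
  fix x y z :: "'k skew" and r q :: 'k
  show "skew_scale r (x + y) = skew_scale r x + skew_scale r y"
    "skew_scale (r + q) x = skew_scale r x + skew_scale q x"
    "skew_scale r (skew_scale q x) = skew_scale (r * q) x" "skew_scale 1 x = x"
    by (auto simp: skew_scale_def fun_eq_iff algebra_simps)
  have add: "skew_mult x (y + z) = skew_mult x y + skew_mult x z"
    "skew_mult (x + y) z = skew_mult x z + skew_mult y z" for x y z :: "'k skew"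
    by (rule skew_eqI; simp add: algebra_simps)+
  show "skew_mult (x + y) z = skew_mult x z + skew_mult y z" by (rule add)
  have sc: "skew_mult (skew_scale r x) y = skew_scale r (skew_mult x y)"
    "skew_mult x (skew_scale r y) = skew_scale r (skew_mult x y)" for r and x y :: "'k skew"
    by (rule skew_eqI; simp add: skew_scale_def algebra_simps)+
  show "skew_mult (skew_scale r x) y = skew_scale r (skew_mult x y)" by (rule sc)
  show "skew_mult (word_value skew_mult skew_generator w) (y + z) =
    skew_mult (word_value skew_mult skew_generator w) y + skew_mult (word_value skew_mult skew_generator w) z" for w
    by (rule add)
  show "skew_mult (word_value skew_mult skew_generator w) (skew_scale r y) =
    skew_scale r (skew_mult (word_value skew_mult skew_generator w) y)" for w
    by (rule sc)
  show "skew_mult skew_one x = x" "skew_mult x skew_one = x"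
    by (rule skew_eqI; simp)+
  show "skew_mult (skew_mult x x) y = skew_mult x (skew_mult x y)" "skew_mult (skew_mult y x) x = skew_mult y (skew_mult x x)"
    by (rule skew_mult_left_alternative skew_mult_right_alternative)+
  show "skew_mult (skew_generator g) (skew_generator h) - skew_mult (skew_generator h) (skew_generator g) =
    linear_extension skew_scale skew_generator (gen_bracket \<gamma> g h)" for g h
  proof -
    have "vector_space (skew_scale :: 'k \<Rightarrow> _)"
      by standard (auto simp: skew_scale_def fun_eq_iff algebra_simps)
    then interpret vector_space "skew_scale :: 'k \<Rightarrow> _" .
    show ?thesis
      by (cases g; cases h; rule skew_eqI; simp add: skew_scale_def)
  qed
qed

text \<open>
The second model, by operators on functions \<open>\<phi>(J, K, M, t)\<close>. Here \<open>d\<close> acts as zero, and the others realize the Lie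
algebra \<open>M/Fd\<close>: \<open>a\<close> multiplies by the variable \<open>t\<close>, while \<open>b\<close>, \<open>c\<close>, \<open>e\<close> raise one of the counters \<open>J\<close>, \<open>K\<close>, \<open>M\<close> and
shift \<open>t\<close> by \<open>1\<close>, \<open>1\<close>, \<open>-\<gamma>\<close>, so that \<open>b a = (a + 1) b\<close>, \<open>c a = (a + 1) c\<close> and \<open>e a = (a - \<gamma>) e\<close>.
\<close>

type_synonym 'k shift_fun = "nat \<Rightarrow> nat \<Rightarrow> nat \<Rightarrow> 'k \<Rightarrow> 'k"
type_synonym 'k shift_op = "'k shift_fun \<Rightarrow> 'k shift_fun"

fun shift_generator :: "'k::field \<Rightarrow> gen \<Rightarrow> 'k shift_op" where
  "shift_generator \<gamma> Ga \<phi> = (\<lambda>J K M t. t * \<phi> J K M t)"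
| "shift_generator \<gamma> Gb \<phi> = (\<lambda>J K M t. \<phi> (J + 1) K M (t + 1))"
| "shift_generator \<gamma> Gc \<phi> = (\<lambda>J K M t. \<phi> J (K + 1) M (t + 1))"
| "shift_generator \<gamma> Gd \<phi> = (\<lambda>J K M t. 0)"
| "shift_generator \<gamma> Ge \<phi> = (\<lambda>J K M t. \<phi> J K (M + 1) (t - \<gamma>))"

definition shift_scale :: "'k::field \<Rightarrow> 'k shift_op \<Rightarrow> 'k shift_op" where
  "shift_scale r X = (\<lambda>\<phi> J K M t. r * X \<phi> J K M t)"

definition shift_linear :: "'k::field shift_op \<Rightarrow> bool" where
  "shift_linear X \<longleftrightarrow> (\<forall>\<phi> \<psi>. X (\<phi> + \<psi>) = X \<phi> + X \<psi>) \<and>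
     (\<forall>r \<phi>. X (\<lambda>J K M t. r * \<phi> J K M t) = (\<lambda>J K M t. r * X \<phi> J K M t))"

lemma shift_linear_generator: "shift_linear (shift_generator \<gamma> g)"
  by (cases g) (auto simp: shift_linear_def fun_eq_iff algebra_simps)

lemma shift_linear_word: "shift_linear (word_value (\<circ>) (shift_generator \<gamma>) w)"
proof (induction w)
  case (Letter g) show ?case by (simp add: shift_linear_generator)
next
  case (Times u v) then show ?case by (simp add: shift_linear_def)
qed

lemmas shift_word_add = shift_linear_word[unfolded shift_linear_def, THEN conjunct1, rule_format]
lemmas shift_word_scale = shift_linear_word[unfolded shift_linear_def, THEN conjunct2, rule_format]

interpretation shift: alternative_representation shift_scale "(\<circ>)" id
    "shift_generator \<gamma> :: gen \<Rightarrow> 'k::field shift_op" "gen_bracket \<gamma>" for \<gamma>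
proof (unfold_locales)
  fix x y z :: "'k shift_op" and r q :: 'k
  have "vector_space (shift_scale :: 'k \<Rightarrow> _)"
    by standard (auto simp: shift_scale_def fun_eq_iff algebra_simps)
  then interpret vector_space "shift_scale :: 'k \<Rightarrow> _" .
  show "shift_scale r (x + y) = shift_scale r x + shift_scale r y"
    "shift_scale (r + q) x = shift_scale r x + shift_scale q x"
    "shift_scale r (shift_scale q x) = shift_scale (r * q) x" "shift_scale 1 x = x"
    by (auto simp: shift_scale_def fun_eq_iff algebra_simps)
  show "(x + y) \<circ> z = (x \<circ> z) + (y \<circ> z)" "shift_scale r x \<circ> y = shift_scale r (x \<circ> y)"
    "id \<circ> x = x" "x \<circ> id = x" "(x \<circ> x) \<circ> y = x \<circ> (x \<circ> y)" "(y \<circ> x) \<circ> x = y \<circ> (x \<circ> x)"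
    by (auto simp: shift_scale_def fun_eq_iff)
  show "word_value (\<circ>) (shift_generator \<gamma>) w \<circ> (y + z) =
      (word_value (\<circ>) (shift_generator \<gamma>) w \<circ> y) + (word_value (\<circ>) (shift_generator \<gamma>) w \<circ> z)" for w
    by (rule ext) (simp add: shift_word_add)
  show "word_value (\<circ>) (shift_generator \<gamma>) w \<circ> shift_scale r y =
      shift_scale r (word_value (\<circ>) (shift_generator \<gamma>) w \<circ> y)" for w
    by (rule ext) (simp add: shift_word_scale shift_scale_def)
  show "(shift_generator \<gamma> g \<circ> shift_generator \<gamma> h) - (shift_generator \<gamma> h \<circ> shift_generator \<gamma> g) =
      linear_extension shift_scale (shift_generator \<gamma>) (gen_bracket \<gamma> g h)" for g h
    by (cases g; cases h; simp add: shift_scale_def fun_eq_iff algebra_simps)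
qed


section \<open>The basis\<close>

lemma (in vector_space) obtain_projection:
  assumes K: "subspace K"
  obtains p where "\<And>x y. p (x + y) = p x + p y" "\<And>r x. p (scale r x) = scale r (p x)"
    "\<And>x. p x - x \<in> K" "\<And>x. x \<in> K \<Longrightarrow> p x = 0"
proof -
  interpret vp: vector_space_pair scale scale ..
  obtain B where B: "B \<subseteq> K" "independent B" "K \<subseteq> span B"
    using maximal_independent_subset[of K] by metis
  let ?E = "extend_basis B"
  define p where "p = vp.construct ?E (\<lambda>b. if b \<in> B then 0 else b)"
  have ind: "independent ?E" and BE: "B \<subseteq> ?E" and sp: "span ?E = UNIV"
    using B(2) by (simp_all add: independent_extend_basis extend_basis_superset)
  have lin: "Vector_Spaces.linear scale scale p"
    unfolding p_def by (rule vp.linear_construct[OF ind])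
  then have p: "p (x + y) = p x + p y" "p (scale r x) = scale r (p x)" for x y r
    by (simp_all add: vp.linear_add vp.linear_scale)
  have basis: "p b = (if b \<in> B then 0 else b)" if "b \<in> ?E" for b
    unfolding p_def by (rule vp.construct_basis[OF ind that])
  have 0: "p 0 = 0" using p(2)[of 0 0] by simp
  have "subspace {x. p x = 0}"
    by (rule subspaceI) (simp_all add: 0 p)
  moreover have "B \<subseteq> {x. p x = 0}" using basis BE by auto
  ultimately have "span B \<subseteq> {x. p x = 0}" by (simp add: span_minimal)
  then have 1: "p x = 0" if "x \<in> K" for x using that B(3) by auto
  have "subspace {x. p x - x \<in> K}"
  proof (rule subspaceI, unfold mem_Collect_eq)
    show "p 0 - 0 \<in> K" by (simp add: 0 subspace_0[OF K])
    show "p (x + y) - (x + y) \<in> K" if "p x - x \<in> K" "p y - y \<in> K" for x y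
      using subspace_add[OF K that] by (simp add: p add_diff_add)
    show "p (scale r x) - scale r x \<in> K" if "p x - x \<in> K" for r x
      using subspace_scale[OF K that] by (simp add: p scale_right_diff_distrib)
  qed
  moreover have "?E \<subseteq> {x. p x - x \<in> K}"
    using basis B(1) by (auto simp: subspace_neg[OF K] subspace_0[OF K])
  ultimately have "span ?E \<subseteq> {x. p x - x \<in> K}" by (simp add: span_minimal)
  then have 2: "p x - x \<in> K" for x using sp by auto
  show ?thesis by (rule that[OF p 2 1])
qed

lemma (in vector_space) span_range_linear_extension:
  assumes "x \<in> span (range f)" shows "\<exists>c. x = linear_extension scale f c"
  using assms
proof (induction rule: span_induct_alt)
  case base show ?case by (rule exI[of _ 0]) simp
next
  case (step r y z)
  then obtain i c where "y = f i" "z = linear_extension scale f c" by auto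
  then show ?case
    by (intro exI[of _ "Poly_Mapping.single i r + c"]) (simp add: linear_extension_add)
qed

definition free_d :: "nat \<Rightarrow> (gen, 'k::field) free" where
  "free_d i = ((\<cdot>) (letter Ga) ^^ i) (letter Gd)"

definition free_abce :: "nat \<Rightarrow> nat \<Rightarrow> nat \<Rightarrow> nat \<Rightarrow> (gen, 'k::field) free" where
  "free_abce i j k m = ((\<cdot>) (letter Ga) ^^ i) (((\<cdot>) (letter Gb) ^^ j)
     (((\<cdot>) (letter Gc) ^^ k) (((\<cdot>) (letter Ge) ^^ m) (word None))))"

fun free_basis :: "nat + nat \<times> nat \<times> nat \<times> nat \<Rightarrow> (gen, 'k::field) free" where
  "free_basis (Inl i) = free_d i"
| "free_basis (Inr (i, j, k, m)) = free_abce i j k m"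

text \<open>
The alternative envelope is a set of cosets. In order to compute in a type, its product is transported to
the free algebra: if \<open>p\<close> is a linear projection with kernel \<open>K\<close>, then \<open>p (x y)\<close> is an alternative product on the whole
space, and it represents the product of cosets.
\<close>

lemma free_basis_spans:
  fixes x :: "(gen, 'k::field_char_0) free"
  assumes "\<gamma> \<noteq> 0"
  shows "\<exists>c. x - linear_extension pm_scale free_basis c \<in> proj_kernel (M_bracket \<gamma>)"
proof -
  define K where "K = proj_kernel (M_bracket \<gamma>)"
  have K: "alg_ideal free_algebra K" unfolding K_def by (rule proj_kernel_ideal)
  then have "pm.subspace K" by (intro pm.subspaceI) (auto simp: free_ideal_iff)
  then obtain p where p: "\<And>x y. p (x + y) = p x + p y" "\<And>r x. p (pm_scale r x) = pm_scale r (p x)"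
    "\<And>x. p x - x \<in> K" "\<And>x. x \<in> K \<Longrightarrow> p x = 0"
    by (rule pm.obtain_projection) blast
  have p0: "p 0 = 0" using p(2)[of 0 0] by simp
  have pminus: "p (- x) = - p x" for x
    using p(1)[of x "- x"] by (simp add: p0 eq_neg_iff_add_eq_0 add.commute)
  have pdiff: "p (x - y) = p x - p y" for x y using p(1)[of x "- y"] by (simp add: pminus)
  have peq: "p x = p y" if "x - y \<in> K" for x y using p(4)[OF that] by (simp add: pdiff)
  \<comment> \<open>projections inside a product may be dropped, since \<open>K\<close> is an ideal\<close>
  have pp [simp]: "p (p x \<cdot> y) = p (x \<cdot> y)" "p (x \<cdot> p y) = p (x \<cdot> y)" "p (p x) = p x" for x y
    using p(3)[of x] p(3)[of y] K
    by (auto intro!: peq simp: free_ideal_iff simp flip: free_mult_diff)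
  let ?G = "\<lambda>g. p (letter g)"
  let ?m = "\<lambda>x y. p (x \<cdot> y)"
  interpret G: malcev_generators pm_scale ?m \<gamma> ?G "p (word None)"
  proof
    fix x y z :: "(gen, 'k) free" and r and g h :: gen
    show "?m (x + y) z = ?m x z + ?m y z" "?m x (y + z) = ?m x y + ?m x z"
      "?m (pm_scale r x) y = pm_scale r (?m x y)" "?m x (pm_scale r y) = pm_scale r (?m x y)"
      by (simp_all add: free_mult_add free_mult_scale p(1,2))
    show "?m (?m x x) y = ?m x (?m x y)" "?m (?m y x) x = ?m y (?m x x)"
      using alternator_in_kernel(1)[of x y "M_bracket \<gamma>"] alternator_in_kernel(2)[of y x "M_bracket \<gamma>"] by (auto intro!: peq simp: K_def)
    show "\<gamma> \<noteq> 0" by fact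
    show "?m (p (word None)) (?G g) = ?G g" "?m (?G g) (p (word None)) = ?G g"
      "?m (p (word None)) (?m x y) = ?m x y" "?m (?m x y) (p (word None)) = ?m x y"
      by simp_all
    have "embed (Poly_Mapping.single g 1) \<cdot> embed (Poly_Mapping.single h 1)
        - embed (Poly_Mapping.single h 1) \<cdot> embed (Poly_Mapping.single g 1)
        - embed (M_bracket \<gamma> (Poly_Mapping.single g 1) (Poly_Mapping.single h 1)) \<in> K"
      unfolding K_def using envelope_relations_subset_kernel[of "M_bracket \<gamma>"]
      by (rule subsetD) (auto simp: envelope_relations_def)
    then have "(letter g \<cdot> letter h - letter h \<cdot> letter g) - embed (gen_bracket \<gamma> g h) \<in> K"
      by (simp add: embed_single M_bracket_def bilinear_extension_single)
    then have "p (letter g \<cdot> letter h - letter h \<cdot> letter g) = p (embed (gen_bracket \<gamma> g h))"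
      by (rule peq)
    also have "\<dots> = linear_extension pm_scale ?G (gen_bracket \<gamma> g h)"
      unfolding embed_eq by (rule linear_extension_compose) (simp_all add: p0 p)
    also have "\<dots> = (\<Sum>x\<in>UNIV. pm_scale (Poly_Mapping.lookup (gen_bracket \<gamma> g h) x) (?G x))"
      by (rule pm.linear_extension_superset) simp_all
    finally show "?m (?G g) (?G h) - ?m (?G h) (?G g) =
        (\<Sum>x\<in>UNIV. pm_scale (Poly_Mapping.lookup (gen_bracket \<gamma> g h) x) (?G x))"
      by (simp add: pdiff)
  qed
  have pow: "((\<lambda>y. p (u \<cdot> y)) ^^ n) (p v) = p (((\<cdot>) u ^^ n) v)" for u v n
    by (induction n) simp_all
  have "G.basis_vector b = p (free_basis b)" for b
    by (cases b rule: free_basis.cases)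
      (simp_all add: G.apow_d_def G.abce_def free_d_def free_abce_def pow)
  then have basis: "G.basis_vector = (\<lambda>b. p (free_basis b))" ..
  have "G.word_val w = p (word (Some w))" for w
    by (induction w) (simp_all add: word_mult_word)
  then have "p (word (Some w)) \<in> G.monomial_span" for w
    using G.word_value_in_S[of w] by simp
  then have "p (word w) \<in> G.monomial_span" for w
    using G.one_in_S by (cases w) simp_all
  then have "linear_extension pm_scale (\<lambda>w. p (word w)) x \<in> G.monomial_span"
    unfolding linear_extension_def
    by (intro pm.subspace_sum G.subspace_S pm.subspace_scale)
  moreover have "p (linear_extension pm_scale f c) = linear_extension pm_scale (\<lambda>i. p (f i)) c"
    for f :: "'i \<Rightarrow> (gen, 'k) free" and c
    by (rule linear_extension_compose) (simp_all add: p0 p)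
  note plin = this
  ultimately have "p x \<in> pm.span (range G.basis_vector)"
    using plin[of word x] by (simp add: linear_extension_pm_single G.monomial_span_def)
  then obtain c where "p x = linear_extension pm_scale (\<lambda>b. p (free_basis b)) c"
    using pm.span_range_linear_extension basis by metis
  then have "p (x - linear_extension pm_scale free_basis c) = 0"
    by (simp add: pdiff linear_extension_compose[where F = p] p0 p)
  then have "- (x - linear_extension pm_scale free_basis c) \<in> K"
    using p(3)[of "x - linear_extension pm_scale free_basis c"] by simp
  then have "pm_scale (- 1) (- (x - linear_extension pm_scale free_basis c)) \<in> K"
    using K unfolding free_ideal_iff by blast
  then show ?thesis by (auto simp: K_def)
qed

lemma (in alternative_representation) eval_letter_power:
  "eval (((\<cdot>) (letter g) ^^ n) x) = ((\<star>) (val g) ^^ n) (eval x)"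
  by (induction n) (simp_all add: eval_mult)

lemma compose_power:
  fixes X :: "'a \<Rightarrow> 'a" and Y :: "'c \<Rightarrow> 'a"
  shows "((\<circ>) X ^^ n) Y = (X ^^ n) \<circ> Y"
  by (induction n) (simp_all add: comp_assoc)

lemma shift_generator_power:
  "(shift_generator \<gamma> Ga ^^ n) \<phi> J K M t = t ^ n * \<phi> J K M t"
  "(shift_generator \<gamma> Gb ^^ n) \<phi> J K M t = \<phi> (J + n) K M (t + of_nat n)"
  "(shift_generator \<gamma> Gc ^^ n) \<phi> J K M t = \<phi> J (K + n) M (t + of_nat n)"
  "(shift_generator \<gamma> Ge ^^ n) \<phi> J K M t = \<phi> J K (M + n) (t - \<gamma> * of_nat n)"
  by (induction n arbitrary: J K M t) (simp_all add: algebra_simps)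

lemma shift_eval_basis:
  "shift.eval \<gamma> (free_d i) \<phi> J K M t = 0"
  "shift.eval \<gamma> (free_abce i j k m) \<phi> J K M t =
     t ^ i * \<phi> (J + j) (K + k) (M + m) (t + (of_nat j + of_nat k - \<gamma> * of_nat m))"
  by (simp_all add: free_d_def free_abce_def shift.eval_letter_power compose_power shift_generator_power algebra_simps)

lemma sum_fun_apply: "sum f I x = (\<Sum>i\<in>I. f i x)"
  for f :: "'i \<Rightarrow> 'a \<Rightarrow> 'b::comm_monoid_add"
  by (induction I rule: infinite_finite_induct) simp_all

text \<open>
\<open>skew_d f\<close> and \<open>skew_abce f j k m\<close> are the elements \<open>f(a) d\<close> and \<open>f(a) b\<^sup>j c\<^sup>k e\<^sup>m\<close> of the first
model.
\<close>

definition skew_d :: "('k::field \<Rightarrow> 'k) \<Rightarrow> 'k skew" where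
  "skew_d f s t = (if s = Sd then f t else 0)"

definition skew_abce :: "('k::field \<Rightarrow> 'k) \<Rightarrow> nat \<Rightarrow> nat \<Rightarrow> nat \<Rightarrow> 'k skew" where
  "skew_abce f j k m s t = (if m = 0 \<and> (s, j, k) \<in> {(S1, 0, 0), (Sb, 1, 0), (Sc, 0, 1), (Sbc, 1, 1)} then f t else 0)"

lemma skew_eval_d: "skew.eval (free_d i) = skew_d (\<lambda>t. t ^ i)"
proof -
  have "((skew_mult (skew_generator Ga)) ^^ i) (skew_generator Gd) = skew_d (\<lambda>t. t ^ i :: 'k::field)"
  proof (induction i)
    case 0 show ?case by (rule skew_eqI; simp add: skew_d_def)
  next
    case (Suc i) then show ?case by (simp, intro skew_eqI) (simp_all add: skew_d_def)
  qed
  then show ?thesis by (simp add: free_d_def skew.eval_letter_power)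
qed

lemma skew_eval_abce: "(skew.eval :: (gen, 'k::field) free \<Rightarrow> _) (free_abce i j k m) = skew_abce (\<lambda>t. t ^ i) j k m"
proof -
  have e: "((skew_mult (skew_generator Ge)) ^^ m) skew_one = skew_abce (\<lambda>t::'k. 1) 0 0 m"
  proof (induction m)
    case 0 show ?case by (rule skew_eqI; simp add: skew_abce_def)
  next
    case (Suc m) then show ?case by (simp, intro skew_eqI) (simp_all add: skew_abce_def)
  qed
  have c: "((skew_mult (skew_generator Gc)) ^^ k) (skew_abce (\<lambda>t::'k. 1) 0 0 m) = skew_abce (\<lambda>t. 1) 0 k m"
  proof (induction k)
    case (Suc k) then show ?case by (simp, intro skew_eqI) (simp_all add: skew_abce_def)
  qed simp
  have b: "((skew_mult (skew_generator Gb)) ^^ j) (skew_abce (\<lambda>t::'k. 1) 0 k m) = skew_abce (\<lambda>t. 1) j k m"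
  proof (induction j)
    case (Suc j) then show ?case by (simp, intro skew_eqI) (simp_all add: skew_abce_def)
  qed simp
  have a: "((skew_mult (skew_generator Ga)) ^^ i) (skew_abce (\<lambda>t::'k. 1) j k m) = skew_abce (\<lambda>t. t ^ i) j k m"
  proof (induction i)
    case (Suc i) then show ?case by (simp, intro skew_eqI) (simp_all add: skew_abce_def)
  qed simp
  show ?thesis by (simp add: free_abce_def skew.eval_letter_power e c b a)
qed

text \<open>
The sum is a polynomial function of \<open>t\<close> whose coefficients are the \<open>c (\<iota> q)\<close>, and a polynomial that
vanishes on an infinite field is zero.
\<close>

lemma power_sum_coefficient_zero:
  fixes c :: "'i \<Rightarrow>\<^sub>0 'k::field_char_0"
  assumes inj: "inj \<iota>" and F: "\<And>q t. F (\<iota> q) t = t ^ q" "\<And>i t. i \<notin> range \<iota> \<Longrightarrow> F i t = 0"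
    and 0: "\<And>t. (\<Sum>i\<in>Poly_Mapping.keys c. Poly_Mapping.lookup c i * F i t) = 0"
  shows "Poly_Mapping.lookup c (\<iota> q) = 0"
proof -
  define Q where "Q = \<iota> -` Poly_Mapping.keys c"
  define P where "P = (\<Sum>q\<in>Q. monom (Poly_Mapping.lookup c (\<iota> q)) q)"
  have fin: "finite Q" unfolding Q_def by (intro finite_vimageI inj) simp
  have "poly P t = 0" for t
  proof -
    have "poly P t = (\<Sum>q\<in>Q. Poly_Mapping.lookup c (\<iota> q) * F (\<iota> q) t)"
      by (simp add: P_def poly_sum poly_monom F)
    also have "\<dots> = (\<Sum>i\<in>\<iota> ` Q. Poly_Mapping.lookup c i * F i t)"
      by (subst sum.reindex) (auto intro: inj_on_subset[OF inj])
    also have "\<dots> = (\<Sum>i\<in>Poly_Mapping.keys c. Poly_Mapping.lookup c i * F i t)"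
      by (intro sum.mono_neutral_left) (auto simp: Q_def F(2) image_iff)
    finally show ?thesis by (simp add: 0)
  qed
  then have "P = 0" using poly_all_0_iff_0 by blast
  then have "coeff P q = 0" by simp
  then have "(\<Sum>q'\<in>Q. if q' = q then Poly_Mapping.lookup c (\<iota> q') else 0) = 0"
    by (simp add: P_def coeff_sum)
  then show ?thesis
    using fin by (simp add: sum.delta Q_def in_keys_iff split: if_splits)
qed

text \<open>
The \<open>d\<close> component of the first model sees the \<open>a\<^sup>i d\<close> only. In the second model, the value at \<open>J = K = M = 0\<close> of
the image of the indicator function of \<open>(j, k, m)\<close> sees the \<open>a\<^sup>i b\<^sup>j c\<^sup>k e\<^sup>m\<close> only.
\<close>

lemma eval_basis_independent:
  fixes c :: "nat + nat \<times> nat \<times> nat \<times> nat \<Rightarrow>\<^sub>0 'k::field_char_0"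
  assumes skew: "skew.eval (linear_extension pm_scale free_basis c) = 0"
    and shift: "shift.eval \<gamma> (linear_extension pm_scale free_basis c) = 0"
  shows "c = 0"
proof (rule poly_mapping_eqI)
  have skew_sum: "(\<Sum>i\<in>Poly_Mapping.keys c. Poly_Mapping.lookup c i * skew.eval (free_basis i) s t) = 0" for s t
  proof -
    have "skew.eval (linear_extension pm_scale free_basis c) = 
      linear_extension skew_scale (\<lambda>i. skew.eval (free_basis i)) c"
      by (rule linear_extension_compose[where F = skew.eval]) (simp_all add: skew.eval_linear)
    then have "linear_extension skew_scale (\<lambda>i. skew.eval (free_basis i)) c s t = 0"
      using skew by simp
    then show ?thesis by (simp add: linear_extension_def skew_scale_def sum_fun_apply)
  qed
  have shift_sum: "(\<Sum>i\<in>Poly_Mapping.keys c. Poly_Mapping.lookup c i * shift.eval \<gamma> (free_basis i) \<phi> J K M t) = 0" for \<phi> J K M t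
  proof -
    have "shift.eval \<gamma> (linear_extension pm_scale free_basis c) = 
      linear_extension shift_scale (\<lambda>i. shift.eval \<gamma> (free_basis i)) c"
      by (rule linear_extension_compose[where F = "shift.eval \<gamma>"]) (simp_all add: shift.eval_linear)
    then have "linear_extension shift_scale (\<lambda>i. shift.eval \<gamma> (free_basis i)) c \<phi> J K M t = 0"
      using shift by simp
    then show ?thesis by (simp add: linear_extension_def shift_scale_def sum_fun_apply)
  qed
  fix b :: "nat + nat \<times> nat \<times> nat \<times> nat"
  show "Poly_Mapping.lookup c b = Poly_Mapping.lookup 0 b"
  proof (cases b rule: free_basis.cases)
    case (1 i)
    have "Poly_Mapping.lookup c (Inl i) = 0"
    proof (rule power_sum_coefficient_zero[where F = "\<lambda>b. skew.eval (free_basis b) Sd"])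
      show "skew.eval (free_basis b) Sd t = 0" if "b \<notin> range Inl" for b and t :: 'k
        using that by (cases b rule: free_basis.cases) (auto simp: skew_eval_abce skew_abce_def)
    qed (simp_all add: skew_sum skew_eval_d skew_d_def)
    then show ?thesis using 1 by simp
  next
    case (2 i j k m)
    \<comment> \<open>the indicator function of the index of the monomial\<close>
    let ?\<phi> = "\<lambda>J K M (t :: 'k). if J = j \<and> K = k \<and> M = m then 1 else 0"
    have "Poly_Mapping.lookup c (Inr (i, j, k, m)) = 0"
    proof (rule power_sum_coefficient_zero[where \<iota> = "\<lambda>i. Inr (i, j, k, m)" and F = "\<lambda>b. shift.eval \<gamma> (free_basis b) ?\<phi> 0 0 0"])
      show "shift.eval \<gamma> (free_basis b) ?\<phi> 0 0 0 t = 0" if "b \<notin> range (\<lambda>i. Inr (i, j, k, m))" for b and t :: 'k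
        using that by (cases b rule: free_basis.cases) (auto simp: shift_eval_basis)
    qed (simp_all add: shift_sum shift_eval_basis inj_def)
    then show ?thesis using 2 by simp
  qed
qed

text \<open>
Modulo the kernel, \<open>x\<close> is a combination of the monomials, and the two models together separate such
combinations.
\<close>

lemma in_proj_kernel_iff:
  fixes x :: "(gen, 'k::field_char_0) free"
  assumes "\<gamma> \<noteq> 0"
  shows "x \<in> proj_kernel (M_bracket \<gamma>) \<longleftrightarrow> skew.eval x = 0 \<and> shift.eval \<gamma> x = 0"
proof
  show "skew.eval x = 0 \<and> shift.eval \<gamma> x = 0" if "x \<in> proj_kernel (M_bracket \<gamma>)" for x
    using that skew.eval_proj_kernel shift.eval_proj_kernel unfolding M_bracket_def by blast
  note eval_0 = this
  assume x: "skew.eval x = 0 \<and> shift.eval \<gamma> x = 0"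
  obtain c where c: "x - linear_extension pm_scale free_basis c \<in> proj_kernel (M_bracket \<gamma>)"
    using free_basis_spans[OF assms] by blast
  from eval_0[OF c] x have "c = 0"
    by (intro eval_basis_independent[where \<gamma> = \<gamma>]) (simp_all add: skew.eval_linear shift.eval_linear)
  then show "x \<in> proj_kernel (M_bracket \<gamma>)" using c by simp
qed

lemma proj_eqI:
  fixes x y :: "(gen, 'k::field_char_0) free"
  assumes "\<gamma> \<noteq> 0" "skew.eval x = skew.eval y" "shift.eval \<gamma> x = shift.eval \<gamma> y"
  shows "proj (M_bracket \<gamma>) x = proj (M_bracket \<gamma>) y"
  using assms by (simp add: proj_eq_iff in_proj_kernel_iff skew.eval_linear shift.eval_linear)


section \<open>The structure constants\<close>

lemma left_tapped_eq:
  "left_tapped (envelope br) (map (\<lambda>g. envelope_embed br (Poly_Mapping.single g 1)) gs) =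
    envelope_ideal br +>\<^bsub>free_algebra\<^esub> foldr (\<lambda>g. (\<cdot>) (letter g)) gs (word None)"
  unfolding left_tapped_def
  by (induction gs) (simp_all add: envelope_simps envelope_embed_def embed_single)

lemma foldr_const_replicate: "foldr (\<lambda>g. f g) (replicate n x) = f x ^^ n"
  by (induction n) simp_all

lemma monomial_eq_proj:
  "mon_d \<gamma> i = proj (M_bracket \<gamma>) (free_d i)"
  "mon_abce \<gamma> i j k m = proj (M_bracket \<gamma>) (free_abce i j k m)"
  unfolding mon_d_def mon_abce_def monomial_A_def monomial_U_def left_tapped_eq proj_def free_d_def free_abce_def
  by (simp_all add: foldr_const_replicate)

lemma basis_family_eq_proj: "basis_family \<gamma> b = proj (M_bracket \<gamma>) (free_basis b)"
  by (cases b rule: free_basis.cases) (simp_all add: monomial_eq_proj)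

lemma lincomb_proj:
  "lincomb (alt_envelope br) (\<lambda>i. proj br (f i)) c = proj br (linear_extension pm_scale f c)"
  by (simp add: lincomb_def proj_simps proj_sum linear_extension_def)

definition free_expand :: "(nat \<Rightarrow> ('g, 'k::field) free) \<Rightarrow> 'k poly \<Rightarrow> ('g, 'k) free" where
  "free_expand v p = (\<Sum>q\<le>degree p. pm_scale (coeff p q) (v q))"

lemma expand_proj: "expand (alt_envelope br) (\<lambda>q. proj br (v q)) p = proj br (free_expand v p)"
  by (simp add: expand_def free_expand_def proj_simps proj_sum)

lemma pol_eq_proj:
  "pol_d \<gamma> p = proj (M_bracket \<gamma>) (free_expand free_d p)"
  "pol_abce \<gamma> p j k m = proj (M_bracket \<gamma>) (free_expand (\<lambda>q. free_abce q j k m) p)"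
  by (simp_all add: pol_d_def pol_abce_def monomial_eq_proj expand_proj)

lemma eval_free_expand:
  "skew.eval (free_expand free_d p) = skew_d (poly p)"
  "skew.eval (free_expand (\<lambda>q. free_abce q j k m) p) = skew_abce (poly p) j k m"
  "shift.eval \<gamma> (free_expand free_d p) = 0"
  "shift.eval \<gamma> (free_expand (\<lambda>q. free_abce q j k m) p) \<phi> J K M t =
     poly p t * \<phi> (J + j) (K + k) (M + m) (t + (of_nat j + of_nat k - \<gamma> * of_nat m))"
proof -
  show "skew.eval (free_expand free_d p) = skew_d (poly p)"
    by (rule ext)+ (simp add: free_expand_def skew.eval_linear skew_eval_d skew_d_def skew_scale_def
        sum_fun_apply poly_altdef)
  show "skew.eval (free_expand (\<lambda>q. free_abce q j k m) p) = skew_abce (poly p) j k m"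
  proof (intro ext)
    fix u t
    show "skew.eval (free_expand (\<lambda>q. free_abce q j k m) p) u t = skew_abce (poly p) j k m u t"
      by (cases "m = 0 \<and> (u, j, k) \<in> {(S1, 0, 0), (Sb, 1, 0), (Sc, 0, 1), (Sbc, 1, 1)}")
        (simp_all only: free_expand_def skew.eval_linear skew_eval_abce skew_abce_def skew_scale_def
          sum_fun_apply poly_altdef if_True if_False mult_zero_right sum.neutral_const simp_thms)
  qed
  show "shift.eval \<gamma> (free_expand free_d p) = 0"
    by (rule ext)+ (simp add: free_expand_def shift.eval_linear shift_eval_basis shift_scale_def sum_fun_apply)
  show "shift.eval \<gamma> (free_expand (\<lambda>q. free_abce q j k m) p) \<phi> J K M t =
     poly p t * \<phi> (J + j) (K + k) (M + m) (t + (of_nat j + of_nat k - \<gamma> * of_nat m))"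
    by (simp add: free_expand_def shift.eval_linear shift_eval_basis shift_scale_def sum_fun_apply
        poly_altdef sum_distrib_right mult.assoc)
qed

lemma poly_ashift [simp]: "poly (ashift r) t = r + t"
  by (simp add: ashift_def)

lemma shift_eval_d: "shift.eval \<gamma> (free_d i) = 0"
  by (rule ext)+ (simp add: shift_eval_basis)

lemma shift_eval_mult: "shift.eval \<gamma> (x \<cdot> y) \<phi> = shift.eval \<gamma> x (shift.eval \<gamma> y \<phi>)"
  by (simp add: shift.eval_mult)

text \<open>
The correction term \<open>T\<close>, with arbitrary coefficient functions \<open>f\<close> and \<open>g\<close> of the two factors in place of
\<open>a\<^sup>i\<close> and \<open>a\<^sup>r\<close>.
\<close>

definition skew_correction :: "nat \<Rightarrow> nat \<Rightarrow> ('k::field \<Rightarrow> 'k) \<Rightarrow> ('k \<Rightarrow> 'k) \<Rightarrow> 'k \<Rightarrow> 'k" where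
  "skew_correction j k f g t =
     (if (j, k) = (1, 0) then f (t - 1) * g (t - 1) - f t * g (t + 1)
      else if (j, k) = (0, 1) then - (f (t - 1) * g (t - 1)) - f t * g (t + 1)
      else if (j, k) = (1, 1) then f t * g (t - 1) - f t * g (t + 2)
      else 0)"

lemma skew_abce_mult:
  "skew_mult (skew_abce f j k m) (skew_abce g n p s) =
     skew_abce (\<lambda>t. f t * g (t + of_nat (j + k))) (j + n) (k + p) (m + s) +
     skew_scale (delta m 0 * delta s 0 * delta (j + n) 1 * delta (k + p) 1) (skew_d (skew_correction j k f g))"
proof (cases "m = 0 \<and> s = 0")
  case True
  have small: "x = 0 \<or> x = 1 \<or> (\<exists>y. x = Suc (Suc y))" for x :: nat by presburger
  show ?thesis
    using True small[of j] small[of k] small[of n] small[of p]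
    by (elim disjE exE conjE; intro skew_eqI;
        simp add: skew_d_def skew_abce_def skew_scale_def delta_def skew_correction_def right_diff_distrib)
next
  case False
  then show ?thesis
    by (intro skew_eqI) (auto simp: skew_d_def skew_abce_def skew_scale_def delta_def)
qed

context
  fixes \<gamma> :: "'k::field_char_0"
  assumes \<gamma>: "\<gamma> \<noteq> 0"
begin

lemma basis_family_is_basis: "is_basis (AM \<gamma>) (basis_family \<gamma>)"
proof -
  have b: "basis_family \<gamma> = (\<lambda>b. proj (M_bracket \<gamma>) (free_basis b))"
    by (rule ext) (rule basis_family_eq_proj)
  have "c = 0" if "proj (M_bracket \<gamma>) (linear_extension pm_scale free_basis c) = \<zero>\<^bsub>AM \<gamma>\<^esub>" for c
  proof -
    have "linear_extension pm_scale free_basis c \<in> proj_kernel (M_bracket \<gamma>)"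
      using that by (simp add: proj_kernel_def)
    then show ?thesis
      using in_proj_kernel_iff[OF \<gamma>] eval_basis_independent by blast
  qed
  moreover have "\<exists>c. proj (M_bracket \<gamma>) x = proj (M_bracket \<gamma>) (linear_extension pm_scale free_basis c)"
    for x :: "(gen, 'k) free"
    unfolding proj_eq_iff by (rule free_basis_spans[OF \<gamma>])
  ultimately show ?thesis
    unfolding is_basis_def b lincomb_proj alt_envelope_carrier by auto
qed

lemma mon_d_mult_mon_d: "mon_d \<gamma> i \<otimes>\<^bsub>AM \<gamma>\<^esub> mon_d \<gamma> r = \<zero>\<^bsub>AM \<gamma>\<^esub>"
  unfolding monomial_eq_proj proj_simps
proof (rule proj_eqI[OF \<gamma>])
  show "skew.eval (free_d i \<cdot> free_d r) = (skew.eval 0 :: 'k skew)"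
    by (simp add: skew.eval_mult skew.eval_linear skew_eval_d, rule skew_eqI) (simp_all add: skew_d_def)
  show "shift.eval \<gamma> (free_d i \<cdot> free_d r) = shift.eval \<gamma> 0"
    by (rule ext)+ (simp add: shift_eval_mult shift_eval_d shift.eval_linear)
qed

lemma mon_d_mult_mon_abce:
  "mon_d \<gamma> i \<otimes>\<^bsub>AM \<gamma>\<^esub> mon_abce \<gamma> r n p s =
     (delta 0 n * delta 0 p * delta 0 s) \<odot>\<^bsub>AM \<gamma>\<^esub> pol_d \<gamma> (ashift 0 ^ i * ashift (- 1) ^ r)"
  unfolding monomial_eq_proj pol_eq_proj proj_simps
proof (rule proj_eqI[OF \<gamma>])
  show "skew.eval (free_d i \<cdot> free_abce r n p s) =
      skew.eval (pm_scale (delta 0 n * delta 0 p * delta 0 s :: 'k) (free_expand free_d (ashift 0 ^ i * ashift (- 1) ^ r)))"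
    unfolding skew.eval_mult skew.eval_linear skew_eval_d skew_eval_abce eval_free_expand
    by (rule skew_eqI) (auto simp: skew_d_def skew_abce_def skew_scale_def delta_def poly_power)
  show "shift.eval \<gamma> (free_d i \<cdot> free_abce r n p s) =
      shift.eval \<gamma> (pm_scale (delta 0 n * delta 0 p * delta 0 s) (free_expand free_d (ashift 0 ^ i * ashift (- 1) ^ r)))"
    by (rule ext)+ (simp add: shift_eval_mult shift_eval_d shift.eval_linear eval_free_expand shift_scale_def)
qed

lemma mon_abce_mult_mon_d:
  "mon_abce \<gamma> i j k m \<otimes>\<^bsub>AM \<gamma>\<^esub> mon_d \<gamma> r =
     (delta j 0 * delta k 0 * delta m 0) \<odot>\<^bsub>AM \<gamma>\<^esub> mon_d \<gamma> (i + r)"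
  unfolding monomial_eq_proj proj_simps
proof (rule proj_eqI[OF \<gamma>])
  show "skew.eval (free_abce i j k m \<cdot> free_d r) =
      skew.eval (pm_scale (delta j 0 * delta k 0 * delta m 0 :: 'k) (free_d (i + r)))"
    unfolding skew.eval_mult skew.eval_linear skew_eval_d skew_eval_abce
    by (rule skew_eqI) (auto simp: skew_d_def skew_abce_def skew_scale_def delta_def power_add)
  show "shift.eval \<gamma> (free_abce i j k m \<cdot> free_d r) =
      shift.eval \<gamma> (pm_scale (delta j 0 * delta k 0 * delta m 0) (free_d (i + r)))"
    by (rule ext)+ (simp add: shift_eval_mult shift_eval_d shift.eval_linear shift_eval_basis shift_scale_def)
qed

definition free_T :: "nat \<Rightarrow> nat \<Rightarrow> nat \<Rightarrow> nat \<Rightarrow> (gen, 'k) free" where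
  "free_T i r j k =
     (if (j, k) = (1, 0) then free_expand free_d (ashift (- 1) ^ (i + r) - ashift 0 ^ i * ashift 1 ^ r)
      else if (j, k) = (0, 1) then free_expand free_d (- (ashift (- 1) ^ (i + r)) - ashift 0 ^ i * ashift 1 ^ r)
      else if (j, k) = (1, 1) then free_expand free_d (ashift 0 ^ i * ashift (- 1) ^ r - ashift 0 ^ i * ashift 2 ^ r)
      else 0)"

lemma T_eq_proj: "T \<gamma> i r j k = proj (M_bracket \<gamma>) (free_T i r j k)"
  by (auto simp: T_def free_T_def pol_eq_proj proj_simps)

lemma mon_abce_mult_mon_abce:
  "mon_abce \<gamma> i j k m \<otimes>\<^bsub>AM \<gamma>\<^esub> mon_abce \<gamma> r n p s =
     pol_abce \<gamma> (ashift 0 ^ i * ashift (of_nat j + of_nat k - \<gamma> * of_nat m) ^ r) (j + n) (k + p) (m + s)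
     \<oplus>\<^bsub>AM \<gamma>\<^esub>
     (delta m 0 * delta s 0 * delta (j + n) 1 * delta (k + p) 1) \<odot>\<^bsub>AM \<gamma>\<^esub> T \<gamma> i r j k"
  unfolding monomial_eq_proj pol_eq_proj T_eq_proj proj_simps
proof (rule proj_eqI[OF \<gamma>])
  let ?c = "delta m 0 * delta s 0 * delta (j + n) 1 * delta (k + p) 1 :: 'k"
  let ?P = "ashift 0 ^ i * ashift (of_nat j + of_nat k - \<gamma> * of_nat m) ^ r"
  show "skew.eval (free_abce i j k m \<cdot> free_abce r n p s) =
      skew.eval (free_expand (\<lambda>q. free_abce q (j + n) (k + p) (m + s)) ?P + pm_scale ?c (free_T i r j k))"
  proof -
    have T: "skew.eval (free_T i r j k) = skew_d (\<lambda>t.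
       (if (j, k) = (1, 0) then (t - 1) ^ (i + r) - t ^ i * (t + 1) ^ r
        else if (j, k) = (0, 1) then - ((t - 1) ^ (i + r)) - t ^ i * (t + 1) ^ r
        else if (j, k) = (1, 1) then t ^ i * (t - 1) ^ r - t ^ i * (t + 2) ^ r
        else 0))"
      by (rule skew_eqI; simp add: free_T_def eval_free_expand skew.eval_linear skew_d_def poly_power add.commute)
    show ?thesis
      unfolding skew.eval_mult skew.eval_linear skew_eval_abce eval_free_expand T skew_abce_mult
      by (rule arg_cong2[where f = "(+)"]; intro ext;
          auto simp: skew_d_def skew_abce_def skew_scale_def skew_correction_def delta_def poly_power power_add
            algebra_simps)
  qed
  show "shift.eval \<gamma> (free_abce i j k m \<cdot> free_abce r n p s) =
      shift.eval \<gamma> (free_expand (\<lambda>q. free_abce q (j + n) (k + p) (m + s)) ?P + pm_scale ?c (free_T i r j k))"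
  proof -
    have "shift.eval \<gamma> (free_T i r j k) = 0"
      by (simp add: free_T_def eval_free_expand shift.eval_linear)
    then show ?thesis
      by (intro ext) (simp add: shift_eval_mult shift.eval_linear eval_free_expand shift_eval_basis shift_scale_def
          poly_power algebra_simps)
  qed
qed

end

theorem theorem7p2:
  fixes \<gamma> :: "'k::field_char_0"
  assumes "\<gamma> \<noteq> 0"
  shows "is_basis (AM \<gamma>) (basis_family \<gamma>) \<and>
    (\<forall>i r. mon_d \<gamma> i \<otimes>\<^bsub>AM \<gamma>\<^esub> mon_d \<gamma> r = \<zero>\<^bsub>AM \<gamma>\<^esub>) \<and>
    (\<forall>i r n p s. mon_d \<gamma> i \<otimes>\<^bsub>AM \<gamma>\<^esub> mon_abce \<gamma> r n p s =
       (delta 0 n * delta 0 p * delta 0 s) \<odot>\<^bsub>AM \<gamma>\<^esub> pol_d \<gamma> (ashift 0 ^ i * ashift (- 1) ^ r)) \<and>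
    (\<forall>i j k m r. mon_abce \<gamma> i j k m \<otimes>\<^bsub>AM \<gamma>\<^esub> mon_d \<gamma> r =
       (delta j 0 * delta k 0 * delta m 0) \<odot>\<^bsub>AM \<gamma>\<^esub> mon_d \<gamma> (i + r)) \<and>
    (\<forall>i j k m r n p s. mon_abce \<gamma> i j k m \<otimes>\<^bsub>AM \<gamma>\<^esub> mon_abce \<gamma> r n p s =
       pol_abce \<gamma> (ashift 0 ^ i * ashift (of_nat j + of_nat k - \<gamma> * of_nat m) ^ r) (j + n) (k + p) (m + s)
       \<oplus>\<^bsub>AM \<gamma>\<^esub>
       (delta m 0 * delta s 0 * delta (j + n) 1 * delta (k + p) 1) \<odot>\<^bsub>AM \<gamma>\<^esub> T \<gamma> i r j k)"
  by (intro conjI allI basis_family_is_basis mon_d_mult_mon_d mon_d_mult_mon_abce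
      mon_abce_mult_mon_d mon_abce_mult_mon_abce assms)

end
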